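(* If $L$ is a frame, then $\mathrm{Sk}\,\Sigma L$ is the spatial reflection of the congruence biframe $\mathbb{C}L$. Furthermore, the functors $L\mapsto\mathrm{Sk}\,\Sigma L$ and $L\mapsto\mathrm{Spat}(\mathbb{C}L)$ from frames to strictly zero-dimensional biframes are naturally isomorphic.
   Context: A biframe is a triple $M=(M_0,M_1,M_2)$ where $M_0$ is a frame and $M_1,M_2$ are subframes whose union generates $M_0$; a biframe homomorphism $M\to N$ is a frame homomorphism $M_0\to N_0$ mapping $M_i$ into $N_i$ for $i=1,2$. $M$ is strictly zero-dimensional if every $a\in M_1$ is complemented in $M_0$ with complement in $M_2$, and these complements generate $M_2$. For a frame $L$, $\Sigma L$ is the spectrum: the set of prime elements $p$ of $L$ ($p\neq1$ and $a\wedge b\le p$ implies $a\le p$ or $b\le p$) with open sets $U_a=\{p\mid a\not\le p\}$, $a\in L$; for a frame homomorphism $f$, $\Sigma f$ is the restriction of the right adjoint $f_*$ to primes. $\Omega X$ is the frame of opens of a space $X$, with $\Omega f=f^{-1}$. The spatial reflection of a frame $L$ is $\mathrm{Spat}\,L=\Omega\Sigma L$ with the surjection $\sigma_L:L\to\Omega\Sigma L$, $\sigma_L(a)=U_a$. The spatial reflection $\mathrm{Spat}\,M$ of a biframe $M$ has total part $\mathrm{Spat}\,M_0$ and first and second parts the images of $M_1$ and $M_2$ under $\sigma_{M_0}$; on morphisms it acts as $\Omega\Sigma$ on total parts. For a topological space $(X,\tau)$, $\mathrm{Sk}\,X$ is the Skula biframe $(\sigma,\tau,\upsilon)$, where $\upsilon$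 is the topology on $X$ with the closed sets of $(X,\tau)$ as basic open sets and $\sigma$ is the topology generated by $\tau\cup\upsilon$; it is strictly zero-dimensional, and $\mathrm{Sk}$ acts on continuous maps by taking preimages. $\mathbb{C}L$ is the frame of frame congruences on $L$ ordered by inclusion, viewed as a biframe $(\mathbb{C}L,\nabla L,\Delta L)$, where $\nabla L=\{\nabla_a\mid a\in L\}$, $\nabla_a=\langle(0,a)\rangle$, and $\Delta L$ is the subframe generated by the congruences $\Delta_a=\langle(a,1)\rangle$. For a frame homomorphism $f:L\to M$, $\mathbb{C}f$ is the unique frame homomorphism with $\mathbb{C}f(\nabla_a)=\nabla_{f(a)}$. *)

theory Defs
  imports "HOL-Analysis.Abstract_Topology" "HOL-Algebra.Complete_Lattice"
begin

locale frame = complete_lattice L for L (structure) +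
  assumes meet_sup_distrib:
    "\<lbrakk>a \<in> carrier L; S \<subseteq> carrier L\<rbrakk> \<Longrightarrow> a \<sqinter> (\<Squnion>S) = \<Squnion>((\<lambda>s. a \<sqinter> s) ` S)"

text \<open>Morphisms are extensional functions, so that equality of morphisms is equality in HOL;
  composition is \<^const>\<open>compose\<close> and the identity of \<open>L\<close> is \<open>\<lambda>x\<in>carrier L. x\<close>.
  Preservation of the bottom element is the case \<open>S = {}\<close>.\<close>

definition frame_hom :: "'a gorder \<Rightarrow> 'b gorder \<Rightarrow> ('a \<Rightarrow> 'b) \<Rightarrow> bool" where
  "frame_hom L M f \<longleftrightarrow> frame L \<and> frame M \<and> f \<in> carrier L \<rightarrow>\<^sub>E carrier M \<and>
     f \<top>\<^bsub>L\<^esub> = \<top>\<^bsub>M\<^esub> \<and>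
     (\<forall>a\<in>carrier L. \<forall>b\<in>carrier L. f (a \<sqinter>\<^bsub>L\<^esub> b) = f a \<sqinter>\<^bsub>M\<^esub> f b) \<and>
     (\<forall>S. S \<subseteq> carrier L \<longrightarrow> f (\<Squnion>\<^bsub>L\<^esub>S) = \<Squnion>\<^bsub>M\<^esub>(f ` S))"

definition subframe :: "'a gorder \<Rightarrow> 'a set \<Rightarrow> bool" where
  "subframe L A \<longleftrightarrow> A \<subseteq> carrier L \<and> \<top>\<^bsub>L\<^esub> \<in> A \<and>
     (\<forall>a\<in>A. \<forall>b\<in>A. a \<sqinter>\<^bsub>L\<^esub> b \<in> A) \<and> (\<forall>S. S \<subseteq> A \<longrightarrow> \<Squnion>\<^bsub>L\<^esub>S \<in> A)"

definition generated_subframe :: "'a gorder \<Rightarrow> 'a set \<Rightarrow> 'a set" where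
  "generated_subframe L S = \<Inter>{A. subframe L A \<and> S \<subseteq> A}"

definition is_complement :: "'a gorder \<Rightarrow> 'a \<Rightarrow> 'a \<Rightarrow> bool" where
  "is_complement L a b \<longleftrightarrow> b \<in> carrier L \<and> a \<sqinter>\<^bsub>L\<^esub> b = \<bottom>\<^bsub>L\<^esub> \<and> a \<squnion>\<^bsub>L\<^esub> b = \<top>\<^bsub>L\<^esub>"

record 'a biframe =
  total_part :: "'a gorder"
  first_part :: "'a set"
  second_part :: "'a set"

definition is_biframe :: "'a biframe \<Rightarrow> bool" where
  "is_biframe M \<longleftrightarrow> frame (total_part M) \<and>
     subframe (total_part M) (first_part M) \<and> subframe (total_part M) (second_part M) \<and>
     generated_subframe (total_part M) (first_part M \<union> second_part M) = carrier (total_part M)"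

definition biframe_hom :: "'a biframe \<Rightarrow> 'b biframe \<Rightarrow> ('a \<Rightarrow> 'b) \<Rightarrow> bool" where
  "biframe_hom M N f \<longleftrightarrow> is_biframe M \<and> is_biframe N \<and>
     frame_hom (total_part M) (total_part N) f \<and>
     f ` first_part M \<subseteq> first_part N \<and> f ` second_part M \<subseteq> second_part N"

definition biframe_iso :: "'a biframe \<Rightarrow> 'b biframe \<Rightarrow> ('a \<Rightarrow> 'b) \<Rightarrow> bool" where
  "biframe_iso M N f \<longleftrightarrow> biframe_hom M N f \<and>
     (\<exists>g. biframe_hom N M g \<and>
        compose (carrier (total_part M)) g f = (\<lambda>x\<in>carrier (total_part M). x) \<and>
        compose (carrier (total_part N)) f g = (\<lambda>y\<in>carrier (total_part N). y))"

definition biframe_isomorphic :: "'a biframe \<Rightarrow> 'b biframe \<Rightarrow> bool" where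
  "biframe_isomorphic M N \<longleftrightarrow> (\<exists>f. biframe_iso M N f)"

definition strictly_zero_dimensional :: "'a biframe \<Rightarrow> bool" where
  "strictly_zero_dimensional M \<longleftrightarrow> is_biframe M \<and>
     (\<forall>a\<in>first_part M. \<exists>b\<in>second_part M. is_complement (total_part M) a b) \<and>
     generated_subframe (total_part M) {b. \<exists>a\<in>first_part M. is_complement (total_part M) a b}
       = second_part M"

definition prime_elements :: "'a gorder \<Rightarrow> 'a set" where
  "prime_elements L = {p \<in> carrier L. p \<noteq> \<top>\<^bsub>L\<^esub> \<and>
     (\<forall>a\<in>carrier L. \<forall>b\<in>carrier L. a \<sqinter>\<^bsub>L\<^esub> b \<sqsubseteq>\<^bsub>L\<^esub> p \<longrightarrow> a \<sqsubseteq>\<^bsub>L\<^esub> p \<or> b \<sqsubseteq>\<^bsub>L\<^esub> p)}"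

definition spectral_open :: "'a gorder \<Rightarrow> 'a \<Rightarrow> 'a set" where
  "spectral_open L a = {p \<in> prime_elements L. \<not> a \<sqsubseteq>\<^bsub>L\<^esub> p}"

definition spectrum :: "'a gorder \<Rightarrow> 'a topology" where
  "spectrum L = topology (\<lambda>U. \<exists>a\<in>carrier L. U = spectral_open L a)"

definition right_adjoint :: "'a gorder \<Rightarrow> 'b gorder \<Rightarrow> ('a \<Rightarrow> 'b) \<Rightarrow> 'b \<Rightarrow> 'a" where
  "right_adjoint L M f b = \<Squnion>\<^bsub>L\<^esub>{a \<in> carrier L. f a \<sqsubseteq>\<^bsub>M\<^esub> b}"

text \<open>For \<open>f : L \<rightarrow> M\<close> this is the map from the spectrum of \<open>M\<close> to that of \<open>L\<close>.\<close>

definition spectrum_map :: "'a gorder \<Rightarrow> 'b gorder \<Rightarrow> ('a \<Rightarrow> 'b) \<Rightarrow> 'b \<Rightarrow> 'a" where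
  "spectrum_map L M f = restrict (right_adjoint L M f) (prime_elements M)"

definition opens :: "'a topology \<Rightarrow> 'a set gorder" where
  "opens X = \<lparr>carrier = {U. openin X U}, eq = (=), le = (\<subseteq>)\<rparr>"

text \<open>For \<open>h : X \<rightarrow> Y\<close> this is the preimage map from the opens of \<open>Y\<close> to those of \<open>X\<close>.\<close>

definition opens_map :: "'a topology \<Rightarrow> 'b topology \<Rightarrow> ('a \<Rightarrow> 'b) \<Rightarrow> 'b set \<Rightarrow> 'a set" where
  "opens_map X Y h = (\<lambda>U\<in>{U. openin Y U}. {x \<in> topspace X. h x \<in> U})"

definition spat :: "'a gorder \<Rightarrow> 'a set gorder" where
  "spat L = opens (spectrum L)"

definition spat_map :: "'a gorder \<Rightarrow> 'b gorder \<Rightarrow> ('a \<Rightarrow> 'b) \<Rightarrow> 'a set \<Rightarrow> 'b set" where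
  "spat_map L M f = opens_map (spectrum M) (spectrum L) (spectrum_map L M f)"

definition biframe_spat :: "'a biframe \<Rightarrow> 'a set biframe" where
  "biframe_spat M = \<lparr>total_part = spat (total_part M),
     first_part = spectral_open (total_part M) ` first_part M,
     second_part = spectral_open (total_part M) ` second_part M\<rparr>"

definition biframe_spat_map :: "'a biframe \<Rightarrow> 'b biframe \<Rightarrow> ('a \<Rightarrow> 'b) \<Rightarrow> 'a set \<Rightarrow> 'b set" where
  "biframe_spat_map M N f = spat_map (total_part M) (total_part N) f"

definition closed_base_topology :: "'a topology \<Rightarrow> 'a topology" where
  "closed_base_topology X = topology (arbitrary union_of closedin X)"

definition skula_topology :: "'a topology \<Rightarrow> 'a topology" where
  "skula_topology X =
     topology_generated_by ({U. openin X U} \<union> {U. openin (closed_base_topology X) U})"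

definition skula :: "'a topology \<Rightarrow> 'a set biframe" where
  "skula X = \<lparr>total_part = opens (skula_topology X),
     first_part = {U. openin X U},
     second_part = {U. openin (closed_base_topology X) U}\<rparr>"

definition skula_map :: "'a topology \<Rightarrow> 'b topology \<Rightarrow> ('a \<Rightarrow> 'b) \<Rightarrow> 'b set \<Rightarrow> 'a set" where
  "skula_map X Y h = opens_map (skula_topology X) (skula_topology Y) h"

text \<open>A frame congruence is an equivalence relation that is a subframe of \<open>L \<times> L\<close>; closure under
  the top pair \<open>(1, 1)\<close> is reflexivity.\<close>

definition frame_congruence :: "'a gorder \<Rightarrow> ('a \<times> 'a) set \<Rightarrow> bool" where
  "frame_congruence L \<theta> \<longleftrightarrow> equiv (carrier L) \<theta> \<and>
     (\<forall>(a, b)\<in>\<theta>. \<forall>(c, d)\<in>\<theta>. (a \<sqinter>\<^bsub>L\<^esub> c, b \<sqinter>\<^bsub>L\<^esub> d) \<in> \<theta>) \<and>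
     (\<forall>R. R \<subseteq> \<theta> \<longrightarrow> (\<Squnion>\<^bsub>L\<^esub>(fst ` R), \<Squnion>\<^bsub>L\<^esub>(snd ` R)) \<in> \<theta>)"

definition congruence_frame :: "'a gorder \<Rightarrow> ('a \<times> 'a) set gorder" where
  "congruence_frame L = \<lparr>carrier = {\<theta>. frame_congruence L \<theta>}, eq = (=), le = (\<subseteq>)\<rparr>"

definition generated_congruence :: "'a gorder \<Rightarrow> ('a \<times> 'a) set \<Rightarrow> ('a \<times> 'a) set" where
  "generated_congruence L R = \<Inter>{\<theta>. frame_congruence L \<theta> \<and> R \<subseteq> \<theta>}"

definition nabla :: "'a gorder \<Rightarrow> 'a \<Rightarrow> ('a \<times> 'a) set" where
  "nabla L a = generated_congruence L {(\<bottom>\<^bsub>L\<^esub>, a)}"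

definition delta :: "'a gorder \<Rightarrow> 'a \<Rightarrow> ('a \<times> 'a) set" where
  "delta L a = generated_congruence L {(a, \<top>\<^bsub>L\<^esub>)}"

definition congruence_biframe :: "'a gorder \<Rightarrow> ('a \<times> 'a) set biframe" where
  "congruence_biframe L = \<lparr>total_part = congruence_frame L,
     first_part = nabla L ` carrier L,
     second_part = generated_subframe (congruence_frame L) (delta L ` carrier L)\<rparr>"

definition congruence_map ::
    "'a gorder \<Rightarrow> 'b gorder \<Rightarrow> ('a \<Rightarrow> 'b) \<Rightarrow> ('a \<times> 'a) set \<Rightarrow> ('b \<times> 'b) set" where
  "congruence_map L M f = (THE g. frame_hom (congruence_frame L) (congruence_frame M) g \<and>
     (\<forall>a\<in>carrier L. g (nabla L a) = nabla M (f a)))"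

definition sk_spectrum :: "'a gorder \<Rightarrow> 'a set biframe" where
  "sk_spectrum L = skula (spectrum L)"

definition sk_spectrum_map :: "'a gorder \<Rightarrow> 'b gorder \<Rightarrow> ('a \<Rightarrow> 'b) \<Rightarrow> 'a set \<Rightarrow> 'b set" where
  "sk_spectrum_map L M f = skula_map (spectrum M) (spectrum L) (spectrum_map L M f)"

definition spat_congruence :: "'a gorder \<Rightarrow> ('a \<times> 'a) set set biframe" where
  "spat_congruence L = biframe_spat (congruence_biframe L)"

definition spat_congruence_map ::
    "'a gorder \<Rightarrow> 'b gorder \<Rightarrow> ('a \<Rightarrow> 'b) \<Rightarrow> ('a \<times> 'a) set set \<Rightarrow> ('b \<times> 'b) set set" where
  "spat_congruence_map L M f =
     biframe_spat_map (congruence_biframe L) (congruence_biframe M) (congruence_map L M f)"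

text \<open>A polymorphic constant such as \<^const>\<open>sk_spectrum\<close> acts on frames over every type, but a
  bound variable has only one type instance.  The predicates below therefore take one argument for
  each type instance that is involved: \<open>F\<close>, \<open>F'\<close> are two instances of an object
  map and \<open>\<Phi>\<close>, \<open>\<Phi>'\<close>, \<open>\<Phi>''\<close> are instances of a morphism map.\<close>

definition functor_objects :: "('a gorder \<Rightarrow> 'c biframe) \<Rightarrow> bool" where
  "functor_objects F \<longleftrightarrow> (\<forall>L. frame L \<longrightarrow> strictly_zero_dimensional (F L))"

definition functor_morphisms ::
    "('a gorder \<Rightarrow> 'c biframe) \<Rightarrow> ('b gorder \<Rightarrow> 'd biframe) \<Rightarrow>
     ('a gorder \<Rightarrow> 'b gorder \<Rightarrow> ('a \<Rightarrow> 'b) \<Rightarrow> 'c \<Rightarrow> 'd) \<Rightarrow> bool" where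
  "functor_morphisms F F' \<Phi> \<longleftrightarrow>
     (\<forall>L M f. frame_hom L M f \<longrightarrow> biframe_hom (F L) (F' M) (\<Phi> L M f))"

definition functor_identity ::
    "('a gorder \<Rightarrow> 'c biframe) \<Rightarrow> ('a gorder \<Rightarrow> 'a gorder \<Rightarrow> ('a \<Rightarrow> 'a) \<Rightarrow> 'c \<Rightarrow> 'c) \<Rightarrow> bool" where
  "functor_identity F \<Phi> \<longleftrightarrow>
     (\<forall>L. frame L \<longrightarrow>
        \<Phi> L L (\<lambda>x\<in>carrier L. x) = (\<lambda>u\<in>carrier (total_part (F L)). u))"

definition functor_composition ::
    "('a gorder \<Rightarrow> 'd biframe) \<Rightarrow>
     ('a gorder \<Rightarrow> 'b gorder \<Rightarrow> ('a \<Rightarrow> 'b) \<Rightarrow> 'd \<Rightarrow> 'e) \<Rightarrow>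
     ('b gorder \<Rightarrow> 'c gorder \<Rightarrow> ('b \<Rightarrow> 'c) \<Rightarrow> 'e \<Rightarrow> 'f) \<Rightarrow>
     ('a gorder \<Rightarrow> 'c gorder \<Rightarrow> ('a \<Rightarrow> 'c) \<Rightarrow> 'd \<Rightarrow> 'f) \<Rightarrow> bool" where
  "functor_composition F \<Phi> \<Phi>' \<Phi>'' \<longleftrightarrow>
     (\<forall>L M N f g. frame_hom L M f \<and> frame_hom M N g \<longrightarrow>
        \<Phi>'' L N (compose (carrier L) g f) =
          compose (carrier (total_part (F L))) (\<Phi>' M N g) (\<Phi> L M f))"

definition iso_components ::
    "('a gorder \<Rightarrow> 'c biframe) \<Rightarrow> ('a gorder \<Rightarrow> 'd biframe) \<Rightarrow> ('a gorder \<Rightarrow> 'c \<Rightarrow> 'd) \<Rightarrow> bool" where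
  "iso_components F G \<eta> \<longleftrightarrow> (\<forall>L. frame L \<longrightarrow> biframe_iso (F L) (G L) (\<eta> L))"

definition natural ::
    "('a gorder \<Rightarrow> 'c biframe) \<Rightarrow>
     ('a gorder \<Rightarrow> 'b gorder \<Rightarrow> ('a \<Rightarrow> 'b) \<Rightarrow> 'c \<Rightarrow> 'e) \<Rightarrow>
     ('a gorder \<Rightarrow> 'b gorder \<Rightarrow> ('a \<Rightarrow> 'b) \<Rightarrow> 'd \<Rightarrow> 'f) \<Rightarrow>
     ('a gorder \<Rightarrow> 'c \<Rightarrow> 'd) \<Rightarrow> ('b gorder \<Rightarrow> 'e \<Rightarrow> 'f) \<Rightarrow> bool" where
  "natural F \<Phi> \<Psi> \<eta> \<eta>' \<longleftrightarrow>
     (\<forall>L M f. frame_hom L M f \<longrightarrow>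
        compose (carrier (total_part (F L))) (\<Psi> L M f) (\<eta> L) =
        compose (carrier (total_part (F L))) (\<eta>' M) (\<Phi> L M f))"

end

theory Submission
  imports Defs
begin

text \<open>
  The prime elements of the congruence frame of \<open>L\<close> correspond to the prime elements of \<open>L\<close>. Since
  \<open>\<nabla>\<^sub>a\<close> and \<open>\<Delta>\<^sub>a\<close> are complementary, a prime congruence \<open>\<theta>\<close> contains exactly one of them, so it
  identifies every \<open>a\<close> with \<open>\<bottom>\<close> or with \<open>\<top>\<close> and has exactly two classes; the class of \<open>\<bottom>\<close> has a
  largest element, which is prime in \<open>L\<close> (\<open>point_congruence_congruence_point\<close>). Conversely, a prime
  \<open>p\<close> gives the prime congruence that relates \<open>x\<close> and \<open>y\<close> when both or neither lie below \<open>p\<close>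
  (\<open>point_congruence_prime\<close>). Under this bijection the spectral open set of \<open>\<nabla>\<^sub>a\<close> is \<open>U\<^sub>a\<close>, that of
  \<open>\<Delta>\<^sub>a\<close> is the complement of \<open>U\<^sub>a\<close>, and that of any \<open>\<theta>\<close> is a union of intersections of two such
  sets (\<open>spectral_open_congruence\<close>). So the spectrum of the congruence frame carries the Skula
  topology of the spectrum of \<open>L\<close>.

  The space of prime congruences with the topology of the sets \<open>U\<close> of the \<open>\<nabla>\<^sub>a\<close> is
  \<open>congruence_point_space L\<close>. The spatial reflection of the congruence biframe is literally its Skula
  biframe (\<open>spat_congruence_eq_skula\<close>), and the action on morphisms is the Skula functor applied to
  a continuous map. Both functors are therefore obtained from functors to topological spaces by
  composing with the Skula functor, which takes values in strictly zero-dimensional biframes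
  (\<open>strictly_zero_dimensional_skula\<close>). The homeomorphism from the prime congruences to the points of
  \<open>L\<close> is the image of the homomorphism \<open>a \<mapsto> \<nabla>\<^sub>a\<close> under the spectrum functor, and naturality of the
  isomorphism is the image of the equation \<open>\<C>f(\<nabla>\<^sub>a) = \<nabla>\<^sub>f\<^sub>(\<^sub>a\<^sub>)\<close> (\<open>congruence_point_natural\<close>).

  Two facts about congruences carry the algebra. The congruences form a frame
  (\<open>frame_congruence_frame\<close>), because congruences pull back along the maps
  \<open>x \<mapsto> (x \<sqinter> b) \<squnion> a\<close>. And the principal congruences of \<open>(a, b)\<close> and \<open>(c, d)\<close>, for \<open>a \<sqsubseteq> b\<close> and
  \<open>c \<sqsubseteq> d\<close>, meet inside any congruence containing \<open>((a \<squnion> c) \<sqinter> (b \<sqinter> d), b \<sqinter> d)\<close>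
  (\<open>principal_Int_subset\<close>). The second fact yields that \<open>a \<mapsto> \<nabla>\<^sub>a\<close> preserves meets, that \<open>\<nabla>\<^sub>a\<close>
  and \<open>\<Delta>\<^sub>a\<close> are complementary, and the existence and uniqueness of \<open>\<C>f\<close>.
\<close>

section \<open>Order-theoretic preliminaries\<close>

lemma (in partial_order) sup_eqI:
  assumes "S \<subseteq> carrier L" "u \<in> carrier L" "\<And>x. x \<in> S \<Longrightarrow> x \<sqsubseteq> u"
    and "\<And>v. \<lbrakk>v \<in> carrier L; \<And>x. x \<in> S \<Longrightarrow> x \<sqsubseteq> v\<rbrakk> \<Longrightarrow> u \<sqsubseteq> v"
  shows "\<Squnion>S = u"
proof -
  have least: "least L u (Upper L S)"
    using assms(1-3) by (intro least_UpperI assms(4)) (auto simp: Upper_def)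
  show ?thesis
    unfolding Lattice.sup_def
    by (rule some_equality) (auto intro: least_unique least)
qed

lemma (in partial_order) inf_eqI:
  assumes "S \<subseteq> carrier L" "u \<in> carrier L" "\<And>x. x \<in> S \<Longrightarrow> u \<sqsubseteq> x"
    and "\<And>v. \<lbrakk>v \<in> carrier L; \<And>x. x \<in> S \<Longrightarrow> v \<sqsubseteq> x\<rbrakk> \<Longrightarrow> v \<sqsubseteq> u"
  shows "\<Sqinter>S = u"
proof -
  have greatest: "greatest L u (Lower L S)"
    using assms(1-3) by (intro greatest_LowerI assms(4)) (auto simp: Lower_def)
  show ?thesis
    unfolding Lattice.inf_def
    by (rule some_equality) (auto intro: greatest_unique greatest)
qed

lemma inclusion_partial_order: "partial_order \<lparr>carrier = C, eq = (=), le = (\<subseteq>)\<rparr>"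
  by standard auto

context frame
begin

(* As introduction rules these make classical search diverge. *)
declare le_cong_l [rule del] le_cong_r [rule del] weak_refl [rule del]
  weak_le_antisym [rule del] le_antisym [rule del]

lemma sup_empty: "\<Squnion>{} = \<bottom>"
  using weak_sup_empty eq_is_equal by simp

lemma join_le_iff:
  "\<lbrakk>x \<in> carrier L; y \<in> carrier L; z \<in> carrier L\<rbrakk> \<Longrightarrow> x \<squnion> y \<sqsubseteq> z \<longleftrightarrow> x \<sqsubseteq> z \<and> y \<sqsubseteq> z"
  by (meson join_closed join_le join_left join_right le_trans)

lemma le_meet_iff:
  "\<lbrakk>x \<in> carrier L; y \<in> carrier L; z \<in> carrier L\<rbrakk> \<Longrightarrow> z \<sqsubseteq> x \<sqinter> y \<longleftrightarrow> z \<sqsubseteq> x \<and> z \<sqsubseteq> y"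
  by (meson meet_closed meet_le meet_left meet_right le_trans)

lemma sup_le_iff:
  "\<lbrakk>S \<subseteq> carrier L; z \<in> carrier L\<rbrakk> \<Longrightarrow> \<Squnion>S \<sqsubseteq> z \<longleftrightarrow> (\<forall>x\<in>S. x \<sqsubseteq> z)"
  by (meson le_trans subsetD sup_closed sup_least sup_upper)

lemma join_absorb: "\<lbrakk>x \<in> carrier L; y \<in> carrier L; x \<sqsubseteq> y\<rbrakk> \<Longrightarrow> x \<squnion> y = y"
  by (simp add: le_iff_meet)

lemma meet_absorb: "\<lbrakk>x \<in> carrier L; y \<in> carrier L; x \<sqsubseteq> y\<rbrakk> \<Longrightarrow> x \<sqinter> y = x"
  using le_iff_join by simp

lemma meet_absorb2: "\<lbrakk>x \<in> carrier L; y \<in> carrier L; y \<sqsubseteq> x\<rbrakk> \<Longrightarrow> x \<sqinter> y = y"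
  using meet_absorb meet_comm by metis

lemma join_absorb2: "\<lbrakk>x \<in> carrier L; y \<in> carrier L; y \<sqsubseteq> x\<rbrakk> \<Longrightarrow> x \<squnion> y = x"
  using join_absorb join_comm by metis

lemma meet_join_distrib:
  assumes "x \<in> carrier L" "y \<in> carrier L" "z \<in> carrier L"
  shows "x \<sqinter> (y \<squnion> z) = (x \<sqinter> y) \<squnion> (x \<sqinter> z)"
  using meet_sup_distrib[of x "{y, z}"] assms by (simp add: join_def)

lemma join_meet_distrib:
  assumes "x \<in> carrier L" "y \<in> carrier L" "z \<in> carrier L"
  shows "x \<squnion> (y \<sqinter> z) = (x \<squnion> y) \<sqinter> (x \<squnion> z)"
proof -
  have "(x \<squnion> y) \<sqinter> (x \<squnion> z) = ((x \<squnion> y) \<sqinter> x) \<squnion> ((x \<squnion> y) \<sqinter> z)"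
    using assms by (simp add: meet_join_distrib)
  also have "(x \<squnion> y) \<sqinter> x = x"
    using assms by (simp add: join_left meet_absorb2)
  also have "(x \<squnion> y) \<sqinter> z = (x \<sqinter> z) \<squnion> (y \<sqinter> z)"
    using assms by (metis meet_comm meet_join_distrib join_closed)
  also have "x \<squnion> ((x \<sqinter> z) \<squnion> (y \<sqinter> z)) = (x \<squnion> (x \<sqinter> z)) \<squnion> (y \<sqinter> z)"
    using assms by (simp add: join_assoc)
  also have "x \<squnion> (x \<sqinter> z) = x"
    using assms by (simp add: meet_left join_absorb2)
  finally show ?thesis ..
qed

end

text \<open>This is what makes a homomorphism out of a congruence frame determined by its values on the
  congruences \<open>\<nabla>\<^sub>a\<close>.\<close>

lemma complement_unique:
  fixes L (structure)
  assumes "frame L" "a \<in> carrier L" "is_complement L a b" "is_complement L a c"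
  shows "b = c"
proof -
  interpret frame L by fact
  have le: "x \<sqsubseteq> y" if "is_complement L a x" "is_complement L a y" for x y
  proof -
    from that have c: "x \<in> carrier L" "y \<in> carrier L" by (auto simp: is_complement_def)
    have "x = x \<sqinter> (a \<squnion> y)"
      using that c by (simp add: is_complement_def meet_absorb)
    also have "\<dots> = (a \<sqinter> x) \<squnion> (x \<sqinter> y)"
      using c assms(2) by (simp add: meet_join_distrib meet_comm[of L a])
    also have "\<dots> = x \<sqinter> y"
      using c assms(2) that(1) by (simp add: is_complement_def join_absorb)
    finally show ?thesis using c le_iff_join by metis
  qed
  have "b \<in> carrier L" "c \<in> carrier L" using assms by (auto simp: is_complement_def)
  then show ?thesis using le[OF assms(3,4)] le[OF assms(4,3)] by (simp add: le_antisym)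
qed

section \<open>Frames of open sets and the Skula functor\<close>

lemma carrier_opens [simp]: "carrier (opens X) = {U. openin X U}"
  and le_opens [simp]: "le (opens X) = (\<subseteq>)"
  by (simp_all add: opens_def)

lemma partial_order_opens: "partial_order (opens X)"
  unfolding opens_def by (rule inclusion_partial_order)

lemma sup_opens:
  assumes "S \<subseteq> {U. openin X U}"
  shows "\<Squnion>\<^bsub>opens X\<^esub>S = \<Union>S"
  using assms by (intro partial_order.sup_eqI[OF partial_order_opens]) auto

lemma join_opens: "\<lbrakk>openin X U; openin X V\<rbrakk> \<Longrightarrow> U \<squnion>\<^bsub>opens X\<^esub> V = U \<union> V"
  by (simp add: join_def sup_opens)

lemma meet_opens:
  assumes "openin X U" "openin X V"
  shows "U \<sqinter>\<^bsub>opens X\<^esub> V = U \<inter> V"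
  unfolding meet_def
  using assms by (intro partial_order.inf_eqI[OF partial_order_opens]) auto

lemma frame_opens: "frame (opens X)"
proof -
  interpret partial_order "opens X" by (rule partial_order_opens)
  interpret complete_lattice "opens X"
  proof (rule complete_latticeI)
    fix A assume A: "A \<subseteq> carrier (opens X)"
    show "\<exists>s. least (opens X) s (Upper (opens X) A)"
      by (rule exI[of _ "\<Union>A"], rule least_UpperI) (use A in \<open>auto simp: Upper_def\<close>)
    show "\<exists>i. greatest (opens X) i (Lower (opens X) A)"
      by (rule exI[of _ "\<Union>{U. openin X U \<and> (\<forall>V\<in>A. U \<subseteq> V)}"], rule greatest_LowerI)
        (use A in \<open>auto simp: Lower_def\<close>)
  qed
  show ?thesis
  proof unfold_locales
    fix a S assume a: "a \<in> carrier (opens X)" and S: "S \<subseteq> carrier (opens X)"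
    have "(\<lambda>s. a \<sqinter>\<^bsub>opens X\<^esub> s) ` S = (\<lambda>s. a \<inter> s) ` S"
      using a S by (intro image_cong refl meet_opens) auto
    moreover have "\<Squnion>\<^bsub>opens X\<^esub>((\<lambda>s. a \<inter> s) ` S) = \<Union>((\<lambda>s. a \<inter> s) ` S)"
      using a S by (intro sup_opens) auto
    moreover have "a \<sqinter>\<^bsub>opens X\<^esub> \<Squnion>\<^bsub>opens X\<^esub>S = a \<inter> \<Union>S"
      using a S by (simp add: sup_opens) (intro meet_opens, auto)
    ultimately show "a \<sqinter>\<^bsub>opens X\<^esub> \<Squnion>\<^bsub>opens X\<^esub>S = \<Squnion>\<^bsub>opens X\<^esub>((\<lambda>s. a \<sqinter>\<^bsub>opens X\<^esub> s) ` S)"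
      by simp
  qed
qed

lemma top_opens: "\<top>\<^bsub>opens X\<^esub> = topspace X"
proof -
  interpret frame "opens X" by (rule frame_opens)
  have "topspace X = \<top>\<^bsub>opens X\<^esub>"
    using top_closed top_higher[of "topspace X"] openin_subset[of X] by auto
  then show ?thesis ..
qed

lemma bottom_opens: "\<bottom>\<^bsub>opens X\<^esub> = {}"
proof -
  interpret frame "opens X" by (rule frame_opens)
  show ?thesis using bottom_lower[of "{}"] by auto
qed

lemma is_complement_opens:
  assumes "openin X U"
  shows "is_complement (opens X) U V \<longleftrightarrow> openin X V \<and> V = topspace X - U"
  using assms openin_subset[of X V] openin_subset[of X U]
  by (auto simp: is_complement_def meet_opens join_opens top_opens bottom_opens)

lemma subframe_opens_iff:
  assumes "A \<subseteq> {U. openin X U}"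
  shows "subframe (opens X) A \<longleftrightarrow>
    topspace X \<in> A \<and> (\<forall>U\<in>A. \<forall>V\<in>A. U \<inter> V \<in> A) \<and> (\<forall>S. S \<subseteq> A \<longrightarrow> \<Union>S \<in> A)"
proof -
  have "(\<forall>U\<in>A. \<forall>V\<in>A. U \<sqinter>\<^bsub>opens X\<^esub> V \<in> A) \<longleftrightarrow> (\<forall>U\<in>A. \<forall>V\<in>A. U \<inter> V \<in> A)"
    using assms by (intro ball_cong refl) (auto simp: meet_opens subset_iff)
  moreover have "(\<forall>S. S \<subseteq> A \<longrightarrow> \<Squnion>\<^bsub>opens X\<^esub>S \<in> A) \<longleftrightarrow> (\<forall>S. S \<subseteq> A \<longrightarrow> \<Union>S \<in> A)"
    using assms by (intro all_cong) (metis sup_opens subset_trans)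
  ultimately show ?thesis using assms by (simp add: subframe_def top_opens)
qed

lemma frame_hom_opens_map:
  assumes h: "continuous_map X Y h"
  shows "frame_hom (opens Y) (opens X) (opens_map X Y h)"
proof -
  have val: "opens_map X Y h U = {x \<in> topspace X. h x \<in> U}" if "openin Y U" for U
    using that by (simp add: opens_map_def)
  have op: "openin X (opens_map X Y h U)" if "openin Y U" for U
    using that h by (simp add: val openin_continuous_map_preimage)
  show ?thesis
    unfolding frame_hom_def
  proof (intro conjI frame_opens allI impI ballI)
    show "opens_map X Y h \<in> carrier (opens Y) \<rightarrow>\<^sub>E carrier (opens X)"
      using op by (auto simp: opens_map_def)
    show "opens_map X Y h \<top>\<^bsub>opens Y\<^esub> = \<top>\<^bsub>opens X\<^esub>"
      using h by (auto simp: top_opens val continuous_map_def)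
  next
    fix U V assume "U \<in> carrier (opens Y)" "V \<in> carrier (opens Y)"
    then have UV: "openin Y U" "openin Y V" by simp_all
    show "opens_map X Y h (U \<sqinter>\<^bsub>opens Y\<^esub> V) = opens_map X Y h U \<sqinter>\<^bsub>opens X\<^esub> opens_map X Y h V"
      unfolding meet_opens[OF UV] meet_opens[OF op[OF UV(1)] op[OF UV(2)]]
      using UV by (auto simp: val openin_Int)
  next
    fix S assume S: "S \<subseteq> carrier (opens Y)"
    have "\<Squnion>\<^bsub>opens X\<^esub>(opens_map X Y h ` S) = \<Union>(opens_map X Y h ` S)"
      using S op by (intro sup_opens) auto
    also have "\<dots> = opens_map X Y h (\<Union>S)"
      using S by (subst val) (auto simp: val subset_iff)
    finally show "opens_map X Y h (\<Squnion>\<^bsub>opens Y\<^esub>S) = \<Squnion>\<^bsub>opens X\<^esub>(opens_map X Y h ` S)"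
      using S by (simp add: sup_opens)
  qed
qed

lemma openin_closed_base:
  "openin (closed_base_topology X) U \<longleftrightarrow> (arbitrary union_of closedin X) U"
  unfolding closed_base_topology_def
  by (simp add: topology_inverse' istopology_base closedin_Int)

lemma closedin_imp_openin_closed_base: "closedin X C \<Longrightarrow> openin (closed_base_topology X) C"
  by (simp add: openin_closed_base arbitrary_union_of_inc)

lemma topspace_closed_base: "topspace (closed_base_topology X) = topspace X"
proof
  have "openin (closed_base_topology X) (topspace (closed_base_topology X))" by simp
  then obtain \<U> where U: "\<U> \<subseteq> Collect (closedin X)" "\<Union>\<U> = topspace (closed_base_topology X)"
    unfolding openin_closed_base by (auto simp: union_of_def arbitrary_def)
  have "\<Union>\<U> \<subseteq> topspace X"
    using U(1) closedin_subset by (intro Union_least) blast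
  then show "topspace (closed_base_topology X) \<subseteq> topspace X"
    using U(2) by simp
  have "openin (closed_base_topology X) (topspace X)"
    by (rule closedin_imp_openin_closed_base) simp
  then show "topspace X \<subseteq> topspace (closed_base_topology X)"
    by (rule openin_subset)
qed

lemma openin_skula:
  "openin (skula_topology X) =
    generate_topology_on ({U. openin X U} \<union> {U. openin (closed_base_topology X) U})"
  by (rule ext) (simp add: skula_topology_def openin_topology_generated_by_iff)

lemma openin_imp_skula: "openin X U \<Longrightarrow> openin (skula_topology X) U"
  and closed_base_imp_skula: "openin (closed_base_topology X) U \<Longrightarrow> openin (skula_topology X) U"
  by (simp_all add: openin_skula generate_topology_on.Basis)

text \<open>To compare another topology with the Skula topology it is enough to look at the open and the
  closed sets of the original space.\<close>

lemma skula_coarsest: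
  assumes "\<And>U. openin X U \<Longrightarrow> openin Z U" "\<And>C. closedin X C \<Longrightarrow> openin Z C"
    and "openin (skula_topology X) U"
  shows "openin Z U"
proof -
  have "openin Z C" if "openin (closed_base_topology X) C" for C
    using that assms(2) unfolding openin_closed_base union_of_def arbitrary_def by auto
  then have "openin Z V" if "V \<in> {U. openin X U} \<union> {U. openin (closed_base_topology X) U}" for V
    using that assms(1) by blast
  then show ?thesis
    using generate_topology_on_coarsest[OF istopology_openin[of Z]] assms(3)
    unfolding openin_skula by blast
qed

lemma topspace_skula [simp]: "topspace (skula_topology X) = topspace X"
  unfolding skula_topology_def topology_generated_by_topspace
  using topspace_closed_base[of X] by (auto simp: topspace_def)

lemma total_part_skula [simp]: "total_part (skula X) = opens (skula_topology X)"
  and first_part_skula [simp]: "first_part (skula X) = {U. openin X U}"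
  and second_part_skula [simp]: "second_part (skula X) = {U. openin (closed_base_topology X) U}"
  by (simp_all add: skula_def)

lemma generated_subframe_eqI:
  assumes "subframe L A" "S \<subseteq> A" "\<And>B. \<lbrakk>subframe L B; S \<subseteq> B\<rbrakk> \<Longrightarrow> A \<subseteq> B"
  shows "generated_subframe L S = A"
  unfolding generated_subframe_def using assms by (intro equalityI Inter_lower Inter_greatest) auto

lemma subframe_opensD:
  assumes "subframe (opens X) A"
  shows "A \<subseteq> {U. openin X U}" "\<And>U V. \<lbrakk>U \<in> A; V \<in> A\<rbrakk> \<Longrightarrow> U \<inter> V \<in> A"
    "\<And>S. S \<subseteq> A \<Longrightarrow> \<Union>S \<in> A"
proof -
  show A: "A \<subseteq> {U. openin X U}" using assms by (simp add: subframe_def)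
  show "\<And>U V. \<lbrakk>U \<in> A; V \<in> A\<rbrakk> \<Longrightarrow> U \<inter> V \<in> A" "\<And>S. S \<subseteq> A \<Longrightarrow> \<Union>S \<in> A"
    using assms by (simp_all add: subframe_opens_iff[OF A])
qed

lemma subframe_opens_skula: "subframe (opens (skula_topology X)) {U. openin X U}"
proof -
  have "{U. openin X U} \<subseteq> {U. openin (skula_topology X) U}"
    using openin_imp_skula by blast
  from subframe_opens_iff[OF this] show ?thesis by (auto intro: openin_Union)
qed

lemma subframe_closed_base_skula:
  "subframe (opens (skula_topology X)) {U. openin (closed_base_topology X) U}"
proof -
  have "{U. openin (closed_base_topology X) U} \<subseteq> {U. openin (skula_topology X) U}"
    using closed_base_imp_skula by blast
  from subframe_opens_iff[OF this] show ?thesis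
    by (auto intro: openin_Union simp: closedin_imp_openin_closed_base)
qed

lemma strictly_zero_dimensional_skula: "strictly_zero_dimensional (skula X)"
proof -
  let ?O = "opens (skula_topology X)"
  have gen: "generated_subframe ?O
      ({U. openin X U} \<union> {U. openin (closed_base_topology X) U}) = {U. openin (skula_topology X) U}"
  proof (rule generated_subframe_eqI)
    show "subframe ?O {U. openin (skula_topology X) U}"
      using openin_topspace[of "skula_topology X"]
        subframe_opens_iff[of "{U. openin (skula_topology X) U}" "skula_topology X"]
      by auto
    show "{U. openin X U} \<union> {U. openin (closed_base_topology X) U} \<subseteq> {U. openin (skula_topology X) U}"
      using openin_imp_skula closed_base_imp_skula by blast
  next
    fix A
    assume A: "subframe ?O A" "{U. openin X U} \<union> {U. openin (closed_base_topology X) U} \<subseteq> A"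
    have "U \<in> A" if "generate_topology_on
        ({U. openin X U} \<union> {U. openin (closed_base_topology X) U}) U" for U
      using that
    proof induction
      case Empty
      then show ?case using subframe_opensD(3)[OF A(1), of "{}"] by simp
    next
      case (Int a b)
      then show ?case using subframe_opensD(2)[OF A(1)] by blast
    next
      case (UN K)
      then show ?case using subframe_opensD(3)[OF A(1), of K] by blast
    next
      case (Basis s)
      then show ?case using A(2) by blast
    qed
    then show "{U. openin (skula_topology X) U} \<subseteq> A"
      unfolding openin_skula by blast
  qed
  have compl_iff: "is_complement ?O U V \<longleftrightarrow> V = topspace X - U" if U: "openin X U" for U V
  proof -
    have "openin (skula_topology X) (topspace X - U)"
      using U by (intro closed_base_imp_skula closedin_imp_openin_closed_base) blast
    then show ?thesis
      unfolding is_complement_opens[OF openin_imp_skula[OF U]] by auto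
  qed
  have compl: "{V. \<exists>U\<in>{U. openin X U}. is_complement ?O U V} = {C. closedin X C}"
  proof (intro equalityI subsetI)
    fix C assume "C \<in> {C. closedin X C}"
    then have "openin X (topspace X - C)" "C = topspace X - (topspace X - C)"
      using closedin_subset[of X C] by auto
    then show "C \<in> {V. \<exists>U\<in>{U. openin X U}. is_complement ?O U V}"
      using compl_iff by blast
  qed (auto simp: compl_iff)
  have gen2: "generated_subframe ?O {C. closedin X C} = {U. openin (closed_base_topology X) U}"
  proof (rule generated_subframe_eqI[OF subframe_closed_base_skula])
    show "{C. closedin X C} \<subseteq> {U. openin (closed_base_topology X) U}"
      using closedin_imp_openin_closed_base by blast
    fix A
    assume A: "subframe ?O A" "{C. closedin X C} \<subseteq> A"
    show "{U. openin (closed_base_topology X) U} \<subseteq> A"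
    proof
      fix U assume "U \<in> {U. openin (closed_base_topology X) U}"
      then obtain S where "S \<subseteq> {C. closedin X C}" "\<Union>S = U"
        unfolding openin_closed_base by (auto simp: union_of_def arbitrary_def)
      then show "U \<in> A" using A(2) subframe_opensD(3)[OF A(1), of S] by blast
    qed
  qed
  have "\<exists>V\<in>{U. openin (closed_base_topology X) U}. is_complement ?O U V" if "openin X U" for U
    using that compl_iff[OF that] closedin_imp_openin_closed_base[of X "topspace X - U"] by blast
  then show ?thesis
    unfolding strictly_zero_dimensional_def is_biframe_def
      total_part_skula first_part_skula second_part_skula gen gen2 compl
    by (simp add: frame_opens subframe_opens_skula subframe_closed_base_skula)
qed

lemma continuous_map_closed_base:
  assumes "continuous_map X Y h" "openin (closed_base_topology Y) U"
  shows "openin (closed_base_topology X) {x \<in> topspace X. h x \<in> U}"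
proof -
  obtain S where S: "S \<subseteq> {C. closedin Y C}" "\<Union>S = U"
    using assms(2) unfolding openin_closed_base by (auto simp: union_of_def arbitrary_def)
  have "{x \<in> topspace X. h x \<in> U} = (\<Union>C\<in>S. {x \<in> topspace X. h x \<in> C})"
    using S(2) by auto
  moreover have "openin (closed_base_topology X) {x \<in> topspace X. h x \<in> C}" if "C \<in> S" for C
    using that S(1) assms(1)
    by (auto intro!: closedin_imp_openin_closed_base closedin_continuous_map_preimage)
  ultimately show ?thesis by (auto intro: openin_Union)
qed

lemma continuous_map_skula:
  assumes h: "continuous_map X Y h"
  shows "continuous_map (skula_topology X) (skula_topology Y) h"
proof -
  let ?S = "{U. openin Y U} \<union> {U. openin (closed_base_topology Y) U}"
  have "openin (skula_topology X) {x \<in> topspace X. h x \<in> U}" if "U \<in> ?S" for U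
    using that openin_imp_skula[OF openin_continuous_map_preimage[OF h]]
      closed_base_imp_skula[OF continuous_map_closed_base[OF h]] by blast
  moreover have "h -` U \<inter> topspace X = {x \<in> topspace X. h x \<in> U}" for U by blast
  moreover have "h ` topspace X \<subseteq> topspace Y"
    by (rule continuous_map_image_subset_topspace[OF h])
  moreover have "topspace Y \<subseteq> \<Union>?S"
    using openin_topspace[of Y] by blast
  ultimately show ?thesis
    unfolding skula_topology_def[of Y] continuous_on_generated_topo_iff topspace_skula
    by (metis (no_types, lifting) subset_trans)
qed

lemma biframe_hom_skula_map:
  assumes h: "continuous_map X Y h"
  shows "biframe_hom (skula Y) (skula X) (skula_map X Y h)"
  unfolding biframe_hom_def
proof (intro conjI)
  show "is_biframe (skula X)" "is_biframe (skula Y)"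
    using strictly_zero_dimensional_skula strictly_zero_dimensional_def by blast+
  show "frame_hom (total_part (skula Y)) (total_part (skula X)) (skula_map X Y h)"
    using frame_hom_opens_map[OF continuous_map_skula[OF h]] by (simp add: skula_map_def)
  show "skula_map X Y h ` first_part (skula Y) \<subseteq> first_part (skula X)"
    using h by (auto simp: skula_map_def opens_map_def openin_imp_skula
        intro: openin_continuous_map_preimage)
  show "skula_map X Y h ` second_part (skula Y) \<subseteq> second_part (skula X)"
    using h by (auto simp: skula_map_def opens_map_def closed_base_imp_skula
        intro: continuous_map_closed_base)
qed

lemma skula_map_id:
  assumes "\<And>x. x \<in> topspace X \<Longrightarrow> h x = x"
  shows "skula_map X X h = (\<lambda>u\<in>carrier (total_part (skula X)). u)"
  unfolding skula_map_def opens_map_def total_part_skula carrier_opens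
  using assms openin_subset by (intro restrict_ext) fastforce

lemma skula_map_compose:
  assumes h: "continuous_map X Y h" and g: "continuous_map Y Z g"
    and k: "\<And>x. x \<in> topspace X \<Longrightarrow> k x = g (h x)"
  shows "skula_map X Z k =
    compose (carrier (total_part (skula Z))) (skula_map X Y h) (skula_map Y Z g)"
proof -
  have "openin (skula_topology Y) {y \<in> topspace Y. g y \<in> U}" if "openin (skula_topology Z) U" for U
    using openin_continuous_map_preimage[OF continuous_map_skula[OF g] that] by simp
  then show ?thesis
    unfolding skula_map_def opens_map_def compose_def total_part_skula carrier_opens
    using h k by (intro restrict_ext) (auto simp: continuous_map_def)
qed

text \<open>Functoriality applied to \<open>k \<circ> h\<close> and \<open>h \<circ> k\<close>, which are identities on the underlying sets.\<close>

lemma biframe_iso_skula_map: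
  assumes h: "continuous_map X Y h" and k: "continuous_map Y X k"
    and kh: "\<And>x. x \<in> topspace X \<Longrightarrow> k (h x) = x" and hk: "\<And>y. y \<in> topspace Y \<Longrightarrow> h (k y) = y"
  shows "biframe_iso (skula Y) (skula X) (skula_map X Y h)"
  unfolding biframe_iso_def
proof (intro conjI exI)
  show "compose (carrier (total_part (skula Y))) (skula_map Y X k) (skula_map X Y h) =
      (\<lambda>x\<in>carrier (total_part (skula Y)). x)"
    using skula_map_compose[OF k h, of "\<lambda>y. y"] skula_map_id[of Y "\<lambda>y. y"] hk by simp
  show "compose (carrier (total_part (skula X))) (skula_map X Y h) (skula_map Y X k) =
      (\<lambda>y\<in>carrier (total_part (skula X)). y)"
    using skula_map_compose[OF h k, of "\<lambda>x. x"] skula_map_id[of X "\<lambda>x. x"] kh by simp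
qed (simp_all add: biframe_hom_skula_map h k)

section \<open>Frame homomorphisms and the spectrum functor\<close>

lemma (in partial_order) eq_if_same_lower:
  assumes "x \<in> carrier L" "y \<in> carrier L" "\<And>a. a \<in> carrier L \<Longrightarrow> a \<sqsubseteq> x \<longleftrightarrow> a \<sqsubseteq> y"
  shows "x = y"
  using assms by (intro le_antisym) auto

lemma frame_homD:
  assumes "frame_hom L M f"
  shows "frame L" "frame M" "\<And>a. a \<in> carrier L \<Longrightarrow> f a \<in> carrier M" "f \<top>\<^bsub>L\<^esub> = \<top>\<^bsub>M\<^esub>"
    "\<And>a b. \<lbrakk>a \<in> carrier L; b \<in> carrier L\<rbrakk> \<Longrightarrow> f (a \<sqinter>\<^bsub>L\<^esub> b) = f a \<sqinter>\<^bsub>M\<^esub> f b"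
    "\<And>S. S \<subseteq> carrier L \<Longrightarrow> f (\<Squnion>\<^bsub>L\<^esub>S) = \<Squnion>\<^bsub>M\<^esub>(f ` S)"
    "f \<in> extensional (carrier L)"
  using assms unfolding frame_hom_def by (auto simp: PiE_def)

lemma frame_hom_bottom:
  assumes "frame_hom L M f"
  shows "f \<bottom>\<^bsub>L\<^esub> = \<bottom>\<^bsub>M\<^esub>"
  using frame_homD(6)[OF assms, of "{}"] frame.sup_empty frame_homD(1,2)[OF assms] by (metis empty_subsetI image_empty)

lemma frame_hom_join:
  assumes "frame_hom L M f" "a \<in> carrier L" "b \<in> carrier L"
  shows "f (a \<squnion>\<^bsub>L\<^esub> b) = f a \<squnion>\<^bsub>M\<^esub> f b"
  using frame_homD(6)[OF assms(1), of "{a, b}"] assms(2,3) by (simp add: join_def)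

lemma frame_hom_mono:
  assumes f: "frame_hom L M f" and "a \<in> carrier L" "b \<in> carrier L" "a \<sqsubseteq>\<^bsub>L\<^esub> b"
  shows "f a \<sqsubseteq>\<^bsub>M\<^esub> f b"
proof -
  interpret L: frame L using f by (rule frame_homD)
  interpret M: frame M using f by (rule frame_homD)
  have "f a \<squnion>\<^bsub>M\<^esub> f b = f b"
    using assms frame_hom_join[OF f, of a b] by (simp add: L.join_absorb)
  then show ?thesis
    using assms by (simp add: M.le_iff_meet frame_homD(3)[OF f])
qed

lemma frame_hom_id: "frame L \<Longrightarrow> frame_hom L L (\<lambda>x\<in>carrier L. x)"
proof -
  assume "frame L"
  then interpret frame L .
  show ?thesis
    unfolding frame_hom_def using \<open>frame L\<close>
    by (auto simp: subset_iff cong: image_cong)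
qed

lemma frame_hom_compose:
  assumes f: "frame_hom L M f" and g: "frame_hom M N g"
  shows "frame_hom L N (compose (carrier L) g f)"
proof -
  interpret L: frame L using f by (rule frame_homD)
  interpret M: frame M using g by (rule frame_homD)
  note fD = frame_homD[OF f] and gD = frame_homD[OF g]
  have "compose (carrier L) g f (\<Squnion>\<^bsub>L\<^esub>S) = \<Squnion>\<^bsub>N\<^esub>(compose (carrier L) g f ` S)"
    if S: "S \<subseteq> carrier L" for S
  proof -
    have "f ` S \<subseteq> carrier M" using S fD(3) by blast
    then have "compose (carrier L) g f (\<Squnion>\<^bsub>L\<^esub>S) = \<Squnion>\<^bsub>N\<^esub>(g ` f ` S)"
      using S fD(6) gD(6) by (simp add: compose_def)
    also have "g ` f ` S = compose (carrier L) g f ` S"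
      using S by (auto simp: compose_def image_image subset_iff intro!: image_cong)
    finally show ?thesis .
  qed
  then show ?thesis
    unfolding frame_hom_def using fD gD by (auto simp: compose_def)
qed

lemma right_adjoint_closed:
  assumes "frame_hom L M f"
  shows "right_adjoint L M f b \<in> carrier L"
proof -
  interpret frame L using assms by (rule frame_homD)
  show ?thesis by (auto simp: right_adjoint_def)
qed

lemma right_adjoint_iff:
  assumes f: "frame_hom L M f" and a: "a \<in> carrier L" and b: "b \<in> carrier M"
  shows "a \<sqsubseteq>\<^bsub>L\<^esub> right_adjoint L M f b \<longleftrightarrow> f a \<sqsubseteq>\<^bsub>M\<^esub> b"
proof -
  interpret L: frame L using f by (rule frame_homD)
  interpret M: frame M using f by (rule frame_homD)
  let ?S = "{a \<in> carrier L. f a \<sqsubseteq>\<^bsub>M\<^esub> b}"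
  have "f (right_adjoint L M f b) = \<Squnion>\<^bsub>M\<^esub>(f ` ?S)"
    unfolding right_adjoint_def by (rule frame_homD[OF f]) auto
  then have le: "f (right_adjoint L M f b) \<sqsubseteq>\<^bsub>M\<^esub> b"
    using b frame_homD(3)[OF f] by (auto intro!: M.sup_least)
  show ?thesis
  proof
    assume "a \<sqsubseteq>\<^bsub>L\<^esub> right_adjoint L M f b"
    then have "f a \<sqsubseteq>\<^bsub>M\<^esub> f (right_adjoint L M f b)"
      by (intro frame_hom_mono[OF f] a right_adjoint_closed[OF f])
    then show "f a \<sqsubseteq>\<^bsub>M\<^esub> b"
      by (rule M.le_trans[OF _ le]) (intro a b frame_homD(3)[OF f] right_adjoint_closed[OF f])+
  next
    assume "f a \<sqsubseteq>\<^bsub>M\<^esub> b"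
    then show "a \<sqsubseteq>\<^bsub>L\<^esub> right_adjoint L M f b"
      unfolding right_adjoint_def using a by (intro L.sup_upper) auto
  qed
qed

lemma prime_elementsI:
  assumes "p \<in> carrier L" "\<not> \<top>\<^bsub>L\<^esub> \<sqsubseteq>\<^bsub>L\<^esub> p" "frame L"
    "\<And>a b. \<lbrakk>a \<in> carrier L; b \<in> carrier L; a \<sqinter>\<^bsub>L\<^esub> b \<sqsubseteq>\<^bsub>L\<^esub> p; \<not> a \<sqsubseteq>\<^bsub>L\<^esub> p\<rbrakk> \<Longrightarrow> b \<sqsubseteq>\<^bsub>L\<^esub> p"
  shows "p \<in> prime_elements L"
proof -
  have "p \<noteq> \<top>\<^bsub>L\<^esub>"
  proof
    interpret frame L by fact
    assume "p = \<top>\<^bsub>L\<^esub>"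
    then show False using assms(2) le_refl[OF top_closed] by metis
  qed
  then show ?thesis using assms(1,4) unfolding prime_elements_def by blast
qed

context
  fixes L :: "'a gorder" (structure)
  assumes L: "frame L"
begin

interpretation frame L by (rule L)

lemma prime_closed: "p \<in> prime_elements L \<Longrightarrow> p \<in> carrier L"
  by (simp add: prime_elements_def)

lemma prime_not_top: "p \<in> prime_elements L \<Longrightarrow> \<not> \<top> \<sqsubseteq> p"
proof
  assume p: "p \<in> prime_elements L" and "\<top> \<sqsubseteq> p"
  then have "p = \<top>"
    using prime_closed[OF p] by (intro le_antisym) simp_all
  with p show False by (simp add: prime_elements_def)
qed

lemma meet_le_prime_iff:
  assumes "p \<in> prime_elements L" "a \<in> carrier L" "b \<in> carrier L"
  shows "a \<sqinter> b \<sqsubseteq> p \<longleftrightarrow> a \<sqsubseteq> p \<or> b \<sqsubseteq> p"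
proof
  have p: "p \<in> carrier L" using assms(1) by (rule prime_closed)
  assume "a \<sqsubseteq> p \<or> b \<sqsubseteq> p"
  then show "a \<sqinter> b \<sqsubseteq> p"
    using le_trans[OF meet_left _ meet_closed[OF assms(2,3)] assms(2) p]
      le_trans[OF meet_right _ meet_closed[OF assms(2,3)] assms(3) p] assms(2,3) by blast
next
  assume "a \<sqinter> b \<sqsubseteq> p"
  then show "a \<sqsubseteq> p \<or> b \<sqsubseteq> p"
    using assms unfolding prime_elements_def by blast
qed

lemma prime_complement:
  assumes "p \<in> prime_elements L" "a \<in> carrier L" "is_complement L a b"
  shows "b \<sqsubseteq> p \<longleftrightarrow> \<not> a \<sqsubseteq> p"
proof -
  from assms have b: "b \<in> carrier L" "a \<sqinter> b = \<bottom>" "a \<squnion> b = \<top>"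
    by (simp_all add: is_complement_def)
  have p: "p \<in> carrier L" using assms(1) by (rule prime_closed)
  have "a \<sqsubseteq> p \<or> b \<sqsubseteq> p"
    using meet_le_prime_iff[OF assms(1,2) b(1)] b(2) p by simp
  moreover have "\<not> (a \<sqsubseteq> p \<and> b \<sqsubseteq> p)"
    using join_le_iff[OF assms(2) b(1) p] b(3) prime_not_top[OF assms(1)] by simp
  ultimately show ?thesis by blast
qed

lemma spectral_open_top: "spectral_open L \<top> = prime_elements L"
  using prime_not_top unfolding spectral_open_def by blast

lemma spectral_open_meet:
  "\<lbrakk>a \<in> carrier L; b \<in> carrier L\<rbrakk> \<Longrightarrow>
    spectral_open L (a \<sqinter> b) = spectral_open L a \<inter> spectral_open L b"
  by (auto simp: spectral_open_def meet_le_prime_iff)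

lemma spectral_open_sup:
  "S \<subseteq> carrier L \<Longrightarrow> spectral_open L (\<Squnion>S) = (\<Union>a\<in>S. spectral_open L a)"
  by (auto simp: spectral_open_def sup_le_iff prime_closed)

lemma openin_spectrum:
  "openin (spectrum L) U \<longleftrightarrow> (\<exists>a\<in>carrier L. U = spectral_open L a)"
proof -
  have "istopology (\<lambda>U. \<exists>a\<in>carrier L. U = spectral_open L a)"
    unfolding istopology_def
  proof (intro conjI allI impI)
    fix S T
    assume "\<exists>a\<in>carrier L. S = spectral_open L a" "\<exists>a\<in>carrier L. T = spectral_open L a"
    then obtain a b where "a \<in> carrier L" "b \<in> carrier L"
      "S = spectral_open L a" "T = spectral_open L b" by auto
    then show "\<exists>a\<in>carrier L. S \<inter> T = spectral_open L a"
      by (intro bexI[of _ "a \<sqinter> b"]) (simp_all add: spectral_open_meet)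
  next
    fix \<K>
    assume K: "\<forall>K\<in>\<K>. \<exists>a\<in>carrier L. K = spectral_open L a"
    define S where "S = {a \<in> carrier L. spectral_open L a \<in> \<K>}"
    have S: "S \<subseteq> carrier L" by (auto simp: S_def)
    have "\<Union>\<K> = (\<Union>a\<in>S. spectral_open L a)"
      using K unfolding S_def by fast
    then have "\<Union>\<K> = spectral_open L (\<Squnion>S)"
      by (simp add: spectral_open_sup[OF S])
    then show "\<exists>a\<in>carrier L. \<Union>\<K> = spectral_open L a"
      using sup_closed[OF S] by (intro bexI[of _ "\<Squnion>S"])
  qed
  then show ?thesis by (simp add: spectrum_def topology_inverse')
qed

lemma topspace_spectrum [simp]: "topspace (spectrum L) = prime_elements L"
proof
  have "openin (spectrum L) (topspace (spectrum L))" by simp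
  then show "topspace (spectrum L) \<subseteq> prime_elements L"
    unfolding openin_spectrum by (auto simp: spectral_open_def)
  have "openin (spectrum L) (spectral_open L \<top>)"
    unfolding openin_spectrum by (intro bexI[of _ \<top>]) simp_all
  then show "prime_elements L \<subseteq> topspace (spectrum L)"
    unfolding spectral_open_top by (rule openin_subset)
qed

end

lemma spectrum_map_iff:
  assumes "frame_hom L M f" "q \<in> prime_elements M" "a \<in> carrier L"
  shows "a \<sqsubseteq>\<^bsub>L\<^esub> spectrum_map L M f q \<longleftrightarrow> f a \<sqsubseteq>\<^bsub>M\<^esub> q"
  using assms right_adjoint_iff[OF assms(1,3)] prime_closed[OF frame_homD(2)[OF assms(1)]]
  by (simp add: spectrum_map_def)

lemma spectrum_map_prime:
  assumes f: "frame_hom L M f" and q: "q \<in> prime_elements M"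
  shows "spectrum_map L M f q \<in> prime_elements L"
proof -
  interpret L: frame L using f by (rule frame_homD)
  interpret M: frame M using f by (rule frame_homD)
  note iff = spectrum_map_iff[OF f q]
  show ?thesis
  proof (rule prime_elementsI[OF _ _ L.frame_axioms])
    show "spectrum_map L M f q \<in> carrier L"
      using q by (simp add: spectrum_map_def right_adjoint_closed[OF f])
    show "\<not> \<top>\<^bsub>L\<^esub> \<sqsubseteq>\<^bsub>L\<^esub> spectrum_map L M f q"
      using prime_not_top[OF M.frame_axioms q] by (simp add: iff frame_homD(4)[OF f])
  next
    fix a b
    assume "a \<in> carrier L" "b \<in> carrier L" "a \<sqinter>\<^bsub>L\<^esub> b \<sqsubseteq>\<^bsub>L\<^esub> spectrum_map L M f q"
      "\<not> a \<sqsubseteq>\<^bsub>L\<^esub> spectrum_map L M f q"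
    then show "b \<sqsubseteq>\<^bsub>L\<^esub> spectrum_map L M f q"
      using meet_le_prime_iff[OF M.frame_axioms q]
      by (simp add: iff frame_homD(3,5)[OF f])
  qed
qed

lemma spectrum_map_vimage:
  assumes f: "frame_hom L M f" and a: "a \<in> carrier L"
  shows "{q \<in> prime_elements M. spectrum_map L M f q \<in> spectral_open L a} = spectral_open M (f a)"
  using spectrum_map_prime[OF f] by (auto simp: spectral_open_def spectrum_map_iff[OF f _ a])

lemma continuous_spectrum_map:
  assumes f: "frame_hom L M f"
  shows "continuous_map (spectrum M) (spectrum L) (spectrum_map L M f)"
  unfolding continuous_map topspace_spectrum[OF frame_homD(1)[OF f]]
    topspace_spectrum[OF frame_homD(2)[OF f]] openin_spectrum[OF frame_homD(1)[OF f]]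
    openin_spectrum[OF frame_homD(2)[OF f]]
  using spectrum_map_prime[OF f] spectrum_map_vimage[OF f] frame_homD(3)[OF f] by blast

text \<open>Functoriality of the spectrum is checked through this characterization, which replaces
  computations with the join defining the right adjoint.\<close>

lemma spectrum_map_eqI:
  assumes f: "frame_hom L M f" and q: "q \<in> prime_elements M" and p: "p \<in> carrier L"
    and iff: "\<And>a. a \<in> carrier L \<Longrightarrow> a \<sqsubseteq>\<^bsub>L\<^esub> p \<longleftrightarrow> f a \<sqsubseteq>\<^bsub>M\<^esub> q"
  shows "spectrum_map L M f q = p"
proof -
  interpret L: frame L using f by (rule frame_homD)
  show ?thesis
    using prime_closed[OF L.frame_axioms spectrum_map_prime[OF f q]] p
    by (intro L.eq_if_same_lower) (simp_all add: spectrum_map_iff[OF f q] iff)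
qed

lemma spectrum_map_id:
  assumes "frame L" "p \<in> prime_elements L"
  shows "spectrum_map L L (\<lambda>x\<in>carrier L. x) p = p"
  by (rule spectrum_map_eqI[OF frame_hom_id]) (use assms prime_closed in auto)

lemma spectrum_map_compose:
  assumes f: "frame_hom L M f" and g: "frame_hom M N g" and q: "q \<in> prime_elements N"
  shows "spectrum_map L N (compose (carrier L) g f) q =
    spectrum_map L M f (spectrum_map M N g q)"
proof (rule spectrum_map_eqI[OF frame_hom_compose[OF f g] q])
  have q': "spectrum_map M N g q \<in> prime_elements M" by (rule spectrum_map_prime[OF g q])
  show "spectrum_map L M f (spectrum_map M N g q) \<in> carrier L"
    using spectrum_map_prime[OF f q'] by (rule prime_closed[OF frame_homD(1)[OF f]])
  show "a \<sqsubseteq>\<^bsub>L\<^esub> spectrum_map L M f (spectrum_map M N g q) \<longleftrightarrow> compose (carrier L) g f a \<sqsubseteq>\<^bsub>N\<^esub> q"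
    if "a \<in> carrier L" for a
    using that
    by (simp add: spectrum_map_iff[OF f q'] spectrum_map_iff[OF g q] frame_homD(3)[OF f] compose_def)
qed

section \<open>The frame of congruences\<close>

lemma (in partial_order) eq_if_same_upper:
  assumes "x \<in> carrier L" "y \<in> carrier L" "\<And>z. z \<in> carrier L \<Longrightarrow> x \<sqsubseteq> z \<longleftrightarrow> y \<sqsubseteq> z"
  shows "x = y"
  using assms by (intro le_antisym) auto

lemma frame_congruenceD:
  assumes "frame_congruence L \<theta>"
  shows "\<theta> \<subseteq> carrier L \<times> carrier L" "\<And>x. x \<in> carrier L \<Longrightarrow> (x, x) \<in> \<theta>"
    "\<And>x y. (x, y) \<in> \<theta> \<Longrightarrow> (y, x) \<in> \<theta>"
    "\<And>x y z. \<lbrakk>(x, y) \<in> \<theta>; (y, z) \<in> \<theta>\<rbrakk> \<Longrightarrow> (x, z) \<in> \<theta>"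
    "\<And>a b c d. \<lbrakk>(a, b) \<in> \<theta>; (c, d) \<in> \<theta>\<rbrakk> \<Longrightarrow> (a \<sqinter>\<^bsub>L\<^esub> c, b \<sqinter>\<^bsub>L\<^esub> d) \<in> \<theta>"
    "\<And>R. R \<subseteq> \<theta> \<Longrightarrow> (\<Squnion>\<^bsub>L\<^esub>(fst ` R), \<Squnion>\<^bsub>L\<^esub>(snd ` R)) \<in> \<theta>"
  using assms unfolding frame_congruence_def equiv_def refl_on_def
  by (auto dest: symD transD)

lemma frame_congruenceI:
  assumes "\<theta> \<subseteq> carrier L \<times> carrier L" "\<And>x. x \<in> carrier L \<Longrightarrow> (x, x) \<in> \<theta>"
    "\<And>x y. (x, y) \<in> \<theta> \<Longrightarrow> (y, x) \<in> \<theta>"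
    "\<And>x y z. \<lbrakk>(x, y) \<in> \<theta>; (y, z) \<in> \<theta>\<rbrakk> \<Longrightarrow> (x, z) \<in> \<theta>"
    "\<And>a b c d. \<lbrakk>(a, b) \<in> \<theta>; (c, d) \<in> \<theta>\<rbrakk> \<Longrightarrow> (a \<sqinter>\<^bsub>L\<^esub> c, b \<sqinter>\<^bsub>L\<^esub> d) \<in> \<theta>"
    "\<And>R. R \<subseteq> \<theta> \<Longrightarrow> (\<Squnion>\<^bsub>L\<^esub>(fst ` R), \<Squnion>\<^bsub>L\<^esub>(snd ` R)) \<in> \<theta>"
  shows "frame_congruence L \<theta>"
proof -
  have "equiv (carrier L) \<theta>"
    using assms(1-4) unfolding equiv_def refl_on_def sym_def trans_def by blast
  then show ?thesis using assms(5,6) unfolding frame_congruence_def by blast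
qed

lemma frame_congruence_closed:
  assumes "frame_congruence L \<theta>" "(x, y) \<in> \<theta>"
  shows "x \<in> carrier L" "y \<in> carrier L"
  using frame_congruenceD(1)[OF assms(1)] assms(2) by auto

lemma frame_congruence_sup:
  assumes "frame_congruence L \<theta>" "\<And>i. i \<in> I \<Longrightarrow> (f i, g i) \<in> \<theta>"
  shows "(\<Squnion>\<^bsub>L\<^esub>(f ` I), \<Squnion>\<^bsub>L\<^esub>(g ` I)) \<in> \<theta>"
proof -
  have "(\<lambda>i. (f i, g i)) ` I \<subseteq> \<theta>" using assms(2) by auto
  from frame_congruenceD(6)[OF assms(1) this] show ?thesis by (simp add: image_image)
qed

lemma frame_congruence_join:
  assumes "frame_congruence L \<theta>" "(a, b) \<in> \<theta>" "(c, d) \<in> \<theta>"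
  shows "(a \<squnion>\<^bsub>L\<^esub> c, b \<squnion>\<^bsub>L\<^esub> d) \<in> \<theta>"
  using frame_congruenceD(6)[OF assms(1), of "{(a, b), (c, d)}"] assms(2,3)
  by (simp add: join_def)

text \<open>The maps \<open>x \<mapsto> (x \<sqinter> b) \<squnion> a\<close> preserve binary meets but in general neither bound, so the empty
  join is allowed to be sent to any \<open>c\<close> below the values. Frame homomorphisms are the case
  \<open>c = \<bottom>\<close>.\<close>

lemma frame_congruence_vimage:
  assumes L: "frame L" and M: "frame M" and \<psi>: "frame_congruence M \<psi>"
    and closed: "\<And>x. x \<in> carrier L \<Longrightarrow> h x \<in> carrier M" and c: "c \<in> carrier M"
    and meet: "\<And>x y. \<lbrakk>x \<in> carrier L; y \<in> carrier L\<rbrakk> \<Longrightarrow> h (x \<sqinter>\<^bsub>L\<^esub> y) = h x \<sqinter>\<^bsub>M\<^esub> h y"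
    and sup: "\<And>S. S \<subseteq> carrier L \<Longrightarrow> h (\<Squnion>\<^bsub>L\<^esub>S) = \<Squnion>\<^bsub>M\<^esub>(h ` S) \<squnion>\<^bsub>M\<^esub> c"
  shows "frame_congruence L {(x, y) \<in> carrier L \<times> carrier L. (h x, h y) \<in> \<psi>}"
proof -
  interpret L: frame L by fact
  interpret M: frame M by fact
  let ?\<theta> = "{(x, y) \<in> carrier L \<times> carrier L. (h x, h y) \<in> \<psi>}"
  note \<psi>D = frame_congruenceD[OF \<psi>]
  show ?thesis
  proof (rule frame_congruenceI)
    fix R assume R: "R \<subseteq> ?\<theta>"
    have sub: "fst ` R \<subseteq> carrier L" "snd ` R \<subseteq> carrier L" using R by auto
    have "(\<Squnion>\<^bsub>M\<^esub>((\<lambda>r. h (fst r)) ` R), \<Squnion>\<^bsub>M\<^esub>((\<lambda>r. h (snd r)) ` R)) \<in> \<psi>"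
      using R by (intro frame_congruence_sup[OF \<psi>]) auto
    then have "(h (\<Squnion>\<^bsub>L\<^esub>(fst ` R)), h (\<Squnion>\<^bsub>L\<^esub>(snd ` R))) \<in> \<psi>"
      unfolding sup[OF sub(1)] sup[OF sub(2)] image_image
      by (rule frame_congruence_join[OF \<psi> _ \<psi>D(2)[OF c]])
    then show "(\<Squnion>\<^bsub>L\<^esub>(fst ` R), \<Squnion>\<^bsub>L\<^esub>(snd ` R)) \<in> ?\<theta>"
      using sub by simp
  next
    show "(x, z) \<in> ?\<theta>" if "(x, y) \<in> ?\<theta>" "(y, z) \<in> ?\<theta>" for x y z
      using that \<psi>D(4)[of "h x" "h y" "h z"] by simp
  next
    show "(a \<sqinter>\<^bsub>L\<^esub> c, b \<sqinter>\<^bsub>L\<^esub> d) \<in> ?\<theta>" if "(a, b) \<in> ?\<theta>" "(c, d) \<in> ?\<theta>" for a b c d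
      using that \<psi>D(5)[of "h a" "h b" "h c" "h d"] by (simp add: meet)
  qed (use \<psi>D(2,3) closed in auto)
qed

lemma frame_congruence_hom_vimage:
  assumes f: "frame_hom L M f" and \<psi>: "frame_congruence M \<psi>"
  shows "frame_congruence L {(x, y) \<in> carrier L \<times> carrier L. (f x, f y) \<in> \<psi>}"
proof -
  interpret M: frame M using f by (rule frame_homD)
  note fD = frame_homD[OF f]
  show ?thesis
  proof (rule frame_congruence_vimage[OF fD(1,2) \<psi> fD(3) M.bottom_closed fD(5)])
    fix S assume S: "S \<subseteq> carrier L"
    then have "\<Squnion>\<^bsub>M\<^esub>(f ` S) \<in> carrier M" using fD(3) by (intro M.sup_closed) blast
    then show "f (\<Squnion>\<^bsub>L\<^esub>S) = \<Squnion>\<^bsub>M\<^esub>(f ` S) \<squnion>\<^bsub>M\<^esub> \<bottom>\<^bsub>M\<^esub>"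
      using S by (simp add: fD(6) M.join_absorb2)
  qed
qed

context
  fixes L :: "'a gorder" (structure)
  assumes L: "frame L"
begin

interpretation frame L by (rule L)

lemma frame_congruence_shift:
  assumes a: "a \<in> carrier L" and b: "b \<in> carrier L" and \<psi>: "frame_congruence L \<psi>"
  shows "frame_congruence L
    {(x, y) \<in> carrier L \<times> carrier L. ((x \<sqinter> b) \<squnion> a, (y \<sqinter> b) \<squnion> a) \<in> \<psi>}"
proof (rule frame_congruence_vimage[OF L L \<psi> _ a])
  fix x y assume xy: "x \<in> carrier L" "y \<in> carrier L"
  have "(x \<sqinter> y) \<sqinter> b = (x \<sqinter> b) \<sqinter> (y \<sqinter> b)"
    using xy b by (intro eq_if_same_lower) (auto simp: le_meet_iff)
  then show "((x \<sqinter> y) \<sqinter> b) \<squnion> a = ((x \<sqinter> b) \<squnion> a) \<sqinter> ((y \<sqinter> b) \<squnion> a)"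
    using xy a b by (simp add: join_comm[of L _ a] join_meet_distrib)
next
  fix S assume S: "S \<subseteq> carrier L"
  have sub: "(\<lambda>s. b \<sqinter> s) ` S \<subseteq> carrier L" "(\<lambda>s. (s \<sqinter> b) \<squnion> a) ` S \<subseteq> carrier L"
    using S a b by auto
  have "\<Squnion>S \<sqinter> b = \<Squnion>((\<lambda>s. b \<sqinter> s) ` S)"
    using meet_sup_distrib[OF b S] by (simp add: meet_comm)
  then have "\<Squnion>S \<sqinter> b \<squnion> a \<sqsubseteq> z \<longleftrightarrow> \<Squnion>((\<lambda>s. (s \<sqinter> b) \<squnion> a) ` S) \<squnion> a \<sqsubseteq> z"
    if "z \<in> carrier L" for z
    using that S a b sub by (auto simp: join_le_iff sup_le_iff meet_comm[of L b] subset_iff)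
  then show "\<Squnion>S \<sqinter> b \<squnion> a = \<Squnion>((\<lambda>s. (s \<sqinter> b) \<squnion> a) ` S) \<squnion> a"
    using S a b sub by (intro eq_if_same_upper) auto
qed (use a b in auto)

lemma frame_congruence_full: "frame_congruence L (carrier L \<times> carrier L)"
proof (rule frame_congruenceI)
  fix R assume "R \<subseteq> carrier L \<times> carrier L"
  then have "fst ` R \<subseteq> carrier L" "snd ` R \<subseteq> carrier L" by auto
  then show "(\<Squnion>(fst ` R), \<Squnion>(snd ` R)) \<in> carrier L \<times> carrier L" by simp
qed auto

lemma frame_congruence_Id: "frame_congruence L (Id_on (carrier L))"
proof (rule frame_congruenceI)
  fix R assume R: "R \<subseteq> Id_on (carrier L)"
  then have "fst ` R \<subseteq> carrier L" "snd ` R = fst ` R" by (auto simp: image_iff) force+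
  then show "(\<Squnion>(fst ` R), \<Squnion>(snd ` R)) \<in> Id_on (carrier L)"
    by (simp add: Id_on_def)
qed auto

lemma frame_congruence_Inter:
  assumes "\<S> \<noteq> {}" and \<S>: "\<And>\<theta>. \<theta> \<in> \<S> \<Longrightarrow> frame_congruence L \<theta>"
  shows "frame_congruence L (\<Inter>\<S>)"
proof (rule frame_congruenceI)
  note SD = frame_congruenceD[OF \<S>]
  show "\<Inter>\<S> \<subseteq> carrier L \<times> carrier L"
    using assms(1) SD(1) by blast
  show "(x, x) \<in> \<Inter>\<S>" if "x \<in> carrier L" for x
    by (rule InterI, rule SD(2)) (use that in auto)
  show "(y, x) \<in> \<Inter>\<S>" if "(x, y) \<in> \<Inter>\<S>" for x y
    by (rule InterI, rule SD(3)) (use that in auto)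
  show "(x, z) \<in> \<Inter>\<S>" if "(x, y) \<in> \<Inter>\<S>" "(y, z) \<in> \<Inter>\<S>" for x y z
    by (rule InterI, rule SD(4)[of _ x y z]) (use that in auto)
  show "(a \<sqinter> c, b \<sqinter> d) \<in> \<Inter>\<S>" if "(a, b) \<in> \<Inter>\<S>" "(c, d) \<in> \<Inter>\<S>" for a b c d
    by (rule InterI, rule SD(5)) (use that in auto)
  show "(\<Squnion>(fst ` R), \<Squnion>(snd ` R)) \<in> \<Inter>\<S>" if "R \<subseteq> \<Inter>\<S>" for R
    by (rule InterI, rule SD(6)) (use that in auto)
qed

lemma frame_congruence_generated:
  assumes "R \<subseteq> carrier L \<times> carrier L"
  shows "frame_congruence L (generated_congruence L R)"
  unfolding generated_congruence_def
  by (rule frame_congruence_Inter) (use assms frame_congruence_full in auto)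

end

lemma generated_congruence_le_iff:
  assumes "frame_congruence L \<theta>"
  shows "generated_congruence L R \<subseteq> \<theta> \<longleftrightarrow> R \<subseteq> \<theta>"
  using assms unfolding generated_congruence_def by auto

lemma carrier_congruence_frame [simp]: "carrier (congruence_frame L) = {\<theta>. frame_congruence L \<theta>}"
  and le_congruence_frame [simp]: "le (congruence_frame L) = (\<subseteq>)"
  by (simp_all add: congruence_frame_def)

lemma partial_order_congruence_frame: "partial_order (congruence_frame L)"
  unfolding congruence_frame_def by (rule inclusion_partial_order)

context
  fixes L :: "'a gorder" (structure)
  assumes L: "frame L"
begin

interpretation frame L by (rule L)

lemma meet_congruence_frame:
  assumes "frame_congruence L \<theta>" "frame_congruence L \<phi>"
  shows "\<theta> \<sqinter>\<^bsub>congruence_frame L\<^esub> \<phi> = \<theta> \<inter> \<phi>"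
proof -
  have "frame_congruence L (\<theta> \<inter> \<phi>)"
    using frame_congruence_Inter[OF L, of "{\<theta>, \<phi>}"] assms by auto
  then show ?thesis
    unfolding meet_def using assms
    by (intro partial_order.inf_eqI[OF partial_order_congruence_frame]) auto
qed

text \<open>Distributivity: a pair \<open>(x, y)\<close> of \<open>\<theta>\<close> is fixed by the map \<open>z \<mapsto> (z \<sqinter> b) \<squnion> a\<close>
  for \<open>a = x \<sqinter> y\<close> and \<open>b = x \<squnion> y\<close>, which sends every pair into \<open>\<theta>\<close> since its values lie between
  the \<open>\<theta>\<close>-related elements \<open>a\<close> and \<open>b\<close>. So the pullback of \<open>\<Squnion>(\<theta> \<inter> \<phi>)\<close> along this map contains
  each \<open>\<phi>\<close>, hence their join.\<close>

lemma frame_congruence_frame: "frame (congruence_frame L)"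
proof -
  let ?C = "congruence_frame L"
  interpret C: partial_order ?C by (rule partial_order_congruence_frame)
  interpret C: complete_lattice ?C
  proof (rule C.complete_lattice_criterion1)
    show "\<exists>g. greatest ?C g (carrier ?C)"
      using frame_congruence_full[OF L] frame_congruenceD(1)[of L]
      by (intro exI[of _ "carrier L \<times> carrier L"]) (auto simp: greatest_def)
    fix A assume A: "A \<subseteq> carrier ?C" "A \<noteq> {}"
    have "frame_congruence L (\<Inter>A)"
      using A by (intro frame_congruence_Inter[OF L]) auto
    then show "\<exists>i. greatest ?C i (Lower ?C A)"
      using A by (intro exI[of _ "\<Inter>A"] greatest_LowerI) (auto simp: Lower_def)
  qed
  show ?thesis
  proof unfold_locales
    fix \<theta> S assume \<theta>: "\<theta> \<in> carrier ?C" and S: "S \<subseteq> carrier ?C"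
    then have \<theta>': "frame_congruence L \<theta>" by simp
    note \<theta>D = frame_congruenceD[OF \<theta>']
    define T where "T = (\<lambda>\<phi>. \<theta> \<sqinter>\<^bsub>?C\<^esub> \<phi>) ` S"
    have T: "T \<subseteq> carrier ?C" using C.meet_closed[OF \<theta>] S unfolding T_def by blast
    have T_eq: "T = (\<lambda>\<phi>. \<theta> \<inter> \<phi>) ` S"
      unfolding T_def using S \<theta>' by (intro image_cong refl meet_congruence_frame) auto
    have sup: "frame_congruence L (\<Squnion>\<^bsub>?C\<^esub>S)" "frame_congruence L (\<Squnion>\<^bsub>?C\<^esub>T)"
      using C.sup_closed[OF S] C.sup_closed[OF T] by simp_all
    have "\<theta> \<inter> \<Squnion>\<^bsub>?C\<^esub>S \<subseteq> \<Squnion>\<^bsub>?C\<^esub>T"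
    proof
      fix z assume "z \<in> \<theta> \<inter> \<Squnion>\<^bsub>?C\<^esub>S"
      then obtain x y where xy: "z = (x, y)" "(x, y) \<in> \<theta>" "(x, y) \<in> \<Squnion>\<^bsub>?C\<^esub>S" by (cases z) auto
      have c: "x \<in> carrier L" "y \<in> carrier L" using frame_congruence_closed[OF \<theta>' xy(2)] by auto
      define a b where "a = x \<sqinter> y" and "b = x \<squnion> y"
      have ab: "a \<in> carrier L" "b \<in> carrier L" using c by (simp_all add: a_def b_def)
      have "(a, y) \<in> \<theta>" "(b, y) \<in> \<theta>"
        using \<theta>D(5)[OF xy(2) \<theta>D(2)[OF c(2)]]
          frame_congruence_join[OF \<theta>' xy(2) \<theta>D(2)[OF c(2)]] c
        by (simp_all add: a_def b_def meet_absorb join_absorb)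
      then have ba: "(b, a) \<in> \<theta>" using \<theta>D(3,4) by blast
      let ?P = "{(x, y) \<in> carrier L \<times> carrier L. ((x \<sqinter> b) \<squnion> a, (y \<sqinter> b) \<squnion> a) \<in> \<Squnion>\<^bsub>?C\<^esub>T}"
      have P: "frame_congruence L ?P"
        by (rule frame_congruence_shift[OF L ab sup(2)])
      have to_a: "((u \<sqinter> b) \<squnion> a, a) \<in> \<theta>" if u: "u \<in> carrier L" for u
        using frame_congruence_join[OF \<theta>' \<theta>D(5)[OF \<theta>D(2)[OF u] ba] \<theta>D(2)[OF ab(1)]] u ab
        by (simp add: join_absorb meet_right)
      have "\<phi> \<subseteq> ?P" if "\<phi> \<in> S" for \<phi>
      proof
        fix w assume w: "w \<in> \<phi>"
        obtain u v where [simp]: "w = (u, v)" by (cases w)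
        have \<phi>: "frame_congruence L \<phi>" using that S by auto
        have uv: "u \<in> carrier L" "v \<in> carrier L"
          using frame_congruence_closed[OF \<phi>] w by auto
        note \<phi>D = frame_congruenceD[OF \<phi>]
        have "((u \<sqinter> b) \<squnion> a, (v \<sqinter> b) \<squnion> a) \<in> \<phi>"
          using frame_congruence_join[OF \<phi> \<phi>D(5)[OF _ \<phi>D(2)[OF ab(2)]] \<phi>D(2)[OF ab(1)]] w
          by simp
        moreover have "((u \<sqinter> b) \<squnion> a, (v \<sqinter> b) \<squnion> a) \<in> \<theta>"
          using \<theta>D(4)[OF to_a[OF uv(1)] \<theta>D(3)[OF to_a[OF uv(2)]]] .
        moreover have "\<theta> \<inter> \<phi> \<subseteq> \<Squnion>\<^bsub>?C\<^esub>T"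
          using C.sup_upper[OF T, of "\<theta> \<inter> \<phi>"] that by (simp add: T_eq)
        ultimately show "w \<in> ?P" using uv by auto
      qed
      then have "\<Squnion>\<^bsub>?C\<^esub>S \<subseteq> ?P"
        using C.sup_least[OF S, of ?P] P by simp
      then have "((x \<sqinter> b) \<squnion> a, (y \<sqinter> b) \<squnion> a) \<in> \<Squnion>\<^bsub>?C\<^esub>T"
        using xy(3) by blast
      moreover have "(x \<sqinter> b) \<squnion> a = x" "(y \<sqinter> b) \<squnion> a = y"
        using c by (simp_all add: a_def b_def meet_absorb join_absorb2 join_left join_right
            meet_left meet_right)
      ultimately show "z \<in> \<Squnion>\<^bsub>?C\<^esub>T" using xy(1) by simp
    qed
    moreover have "\<Squnion>\<^bsub>?C\<^esub>T \<subseteq> \<theta> \<inter> \<Squnion>\<^bsub>?C\<^esub>S"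
    proof -
      have "\<Squnion>\<^bsub>?C\<^esub>T \<subseteq> \<theta>" using C.sup_least[OF T \<theta>] by (auto simp: T_eq)
      moreover have "\<phi> \<subseteq> \<Squnion>\<^bsub>?C\<^esub>S" if "\<phi> \<in> S" for \<phi>
        using C.sup_upper[OF S that] by simp
      then have "\<Squnion>\<^bsub>?C\<^esub>T \<subseteq> \<Squnion>\<^bsub>?C\<^esub>S"
        using C.sup_least[OF T C.sup_closed[OF S]] by (auto simp: T_eq)
      ultimately show ?thesis by blast
    qed
    ultimately show "\<theta> \<sqinter>\<^bsub>?C\<^esub> \<Squnion>\<^bsub>?C\<^esub>S = \<Squnion>\<^bsub>?C\<^esub>((\<lambda>\<phi>. \<theta> \<sqinter>\<^bsub>?C\<^esub> \<phi>) ` S)"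
      unfolding T_def[symmetric] using meet_congruence_frame[OF \<theta>' sup(1)] by simp
  qed
qed

end

section \<open>Principal congruences\<close>

definition nabla_map :: "'a gorder \<Rightarrow> 'a \<Rightarrow> ('a \<times> 'a) set" where
  "nabla_map L = restrict (nabla L) (carrier L)"

context
  fixes L :: "'a gorder" (structure)
  assumes L: "frame L"
begin

interpretation frame L by (rule L)
interpretation C: frame "congruence_frame L" by (rule frame_congruence_frame[OF L])

lemma principal_congruence:
  "\<lbrakk>a \<in> carrier L; b \<in> carrier L\<rbrakk> \<Longrightarrow> frame_congruence L (generated_congruence L {(a, b)})"
  by (rule frame_congruence_generated[OF L]) simp

lemma nabla_congruence: "a \<in> carrier L \<Longrightarrow> frame_congruence L (nabla L a)"
  and delta_congruence: "a \<in> carrier L \<Longrightarrow> frame_congruence L (delta L a)"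
  by (simp_all add: nabla_def delta_def principal_congruence)

lemma nabla_le_iff: "frame_congruence L \<theta> \<Longrightarrow> nabla L a \<subseteq> \<theta> \<longleftrightarrow> (\<bottom>, a) \<in> \<theta>"
  and delta_le_iff: "frame_congruence L \<theta> \<Longrightarrow> delta L a \<subseteq> \<theta> \<longleftrightarrow> (a, \<top>) \<in> \<theta>"
  by (simp_all add: nabla_def delta_def generated_congruence_le_iff)

lemma nabla_mem: "a \<in> carrier L \<Longrightarrow> (\<bottom>, a) \<in> nabla L a"
  and delta_mem: "a \<in> carrier L \<Longrightarrow> (a, \<top>) \<in> delta L a"
  using nabla_le_iff[OF nabla_congruence, of a a] delta_le_iff[OF delta_congruence, of a a] by simp_all

lemma frame_congruence_join_kernel:
  assumes v: "v \<in> carrier L"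
  shows "frame_congruence L {(x, y) \<in> carrier L \<times> carrier L. x \<squnion> v = y \<squnion> v}"
proof -
  have "{(x, y) \<in> carrier L \<times> carrier L. x \<squnion> v = y \<squnion> v} =
      {(x, y) \<in> carrier L \<times> carrier L. ((x \<sqinter> \<top>) \<squnion> v, (y \<sqinter> \<top>) \<squnion> v) \<in> Id_on (carrier L)}"
    using v by (auto simp: meet_absorb Id_on_def)
  then show ?thesis
    using frame_congruence_shift[OF L v top_closed frame_congruence_Id[OF L]] by simp
qed

lemma frame_congruence_meet_kernel:
  assumes u: "u \<in> carrier L"
  shows "frame_congruence L {(x, y) \<in> carrier L \<times> carrier L. x \<sqinter> u = y \<sqinter> u}"
proof -
  have "{(x, y) \<in> carrier L \<times> carrier L. x \<sqinter> u = y \<sqinter> u} =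
      {(x, y) \<in> carrier L \<times> carrier L. ((x \<sqinter> u) \<squnion> \<bottom>, (y \<sqinter> u) \<squnion> \<bottom>) \<in> Id_on (carrier L)}"
    using u by (auto simp: join_absorb2 Id_on_def)
  then show ?thesis
    using frame_congruence_shift[OF L bottom_closed u frame_congruence_Id[OF L]] by simp
qed

text \<open>Two elements related by \<open>\<langle>(u, v)\<rangle>\<close> have the same join with \<open>v\<close> and the same meet with \<open>u\<close>.
  Elements in both principal congruences therefore have the same join with \<open>v \<sqinter> v'\<close> and the same
  meet with \<open>u \<squnion> u'\<close>, and differ only by what happens between these two elements.\<close>

lemma principal_Int_subset:
  assumes c: "u \<in> carrier L" "v \<in> carrier L" "u' \<in> carrier L" "v' \<in> carrier L"
    and le: "u \<sqsubseteq> v" "u' \<sqsubseteq> v'" and \<chi>: "frame_congruence L \<chi>"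
    and mem: "((u \<squnion> u') \<sqinter> (v \<sqinter> v'), v \<sqinter> v') \<in> \<chi>"
  shows "generated_congruence L {(u, v)} \<inter> generated_congruence L {(u', v')} \<subseteq> \<chi>"
proof (rule subsetI)
  note \<chi>D = frame_congruenceD[OF \<chi>]
  define w e where "w = v \<sqinter> v'" and "e = u \<squnion> u'"
  have we: "w \<in> carrier L" "e \<in> carrier L" using c by (simp_all add: w_def e_def)
  have joins: "x \<squnion> v = y \<squnion> v \<and> x \<sqinter> u = y \<sqinter> u"
    if "(x, y) \<in> generated_congruence L {(u, v)}" "u \<in> carrier L" "v \<in> carrier L" "u \<sqsubseteq> v" for x y u v
  proof -
    have "u \<squnion> v = v" "v \<squnion> v = v" "u \<sqinter> u = u" "v \<sqinter> u = u"
      using that(2-4) join_absorb[of u v] join_absorb[of v v] meet_absorb[of u u] meet_absorb2[of v u]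
      by simp_all
    then have sub: "{(u, v)} \<subseteq> {(x, y) \<in> carrier L \<times> carrier L. x \<squnion> v = y \<squnion> v}"
      "{(u, v)} \<subseteq> {(x, y) \<in> carrier L \<times> carrier L. x \<sqinter> u = y \<sqinter> u}"
      using that(2,3) by simp_all
    have "(x, y) \<in> {(x, y) \<in> carrier L \<times> carrier L. x \<squnion> v = y \<squnion> v}"
      using generated_congruence_le_iff[OF frame_congruence_join_kernel[OF that(3)], THEN iffD2, OF sub(1)]
        that(1) by (rule subsetD)
    moreover have "(x, y) \<in> {(x, y) \<in> carrier L \<times> carrier L. x \<sqinter> u = y \<sqinter> u}"
      using generated_congruence_le_iff[OF frame_congruence_meet_kernel[OF that(2)], THEN iffD2, OF sub(2)]
        that(1) by (rule subsetD)
    ultimately show ?thesis by simp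
  qed
  have half: "(x, x \<sqinter> y) \<in> \<chi>"
    if xy: "x \<in> carrier L" "y \<in> carrier L" and "x \<squnion> w = y \<squnion> w" "x \<sqinter> e = y \<sqinter> e" for x y
  proof -
    have "x \<sqinter> (e \<sqinter> w) = (y \<sqinter> e) \<sqinter> w"
      using that we by (simp add: meet_assoc[symmetric])
    then have le_y: "x \<sqinter> (e \<sqinter> w) \<sqsubseteq> y"
      using xy we meet_left[of y "e \<sqinter> w"] by (simp add: meet_assoc)
    have "x = x \<sqinter> (y \<squnion> w)"
      using meet_absorb[of x "x \<squnion> w"] xy we join_left[of x w] that(3) by simp
    also have "\<dots> = (x \<sqinter> y) \<squnion> (x \<sqinter> w)"
      using xy we by (simp add: meet_join_distrib)
    finally have x: "x = (x \<sqinter> y) \<squnion> (x \<sqinter> w)" .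
    have "(w, e \<sqinter> w) \<in> \<chi>"
      using \<chi>D(3)[OF mem] by (simp add: w_def e_def)
    then have "((x \<sqinter> y) \<squnion> (x \<sqinter> w), (x \<sqinter> y) \<squnion> (x \<sqinter> (e \<sqinter> w))) \<in> \<chi>"
      using xy we by (intro frame_congruence_join[OF \<chi> \<chi>D(2)] \<chi>D(5)[OF \<chi>D(2)]) simp_all
    moreover have "(x \<sqinter> y) \<squnion> (x \<sqinter> (e \<sqinter> w)) = x \<sqinter> y"
      using xy we le_y by (simp add: join_absorb2 le_meet_iff meet_left)
    ultimately show ?thesis using x by metis
  qed
  fix z
  assume z: "z \<in> generated_congruence L {(u, v)} \<inter> generated_congruence L {(u', v')}"
  obtain x y where xy: "z = (x, y)" by (cases z)
  have cl: "x \<in> carrier L" "y \<in> carrier L"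
    using z frame_congruence_closed[OF principal_congruence[OF c(1,2)]] by (auto simp: xy)
  have "x \<squnion> v = y \<squnion> v" "x \<sqinter> u = y \<sqinter> u" "x \<squnion> v' = y \<squnion> v'" "x \<sqinter> u' = y \<sqinter> u'"
    using z joins[of x y u v] joins[of x y u' v'] c le by (auto simp: xy)
  then have "x \<squnion> w = y \<squnion> w" "x \<sqinter> e = y \<sqinter> e"
    unfolding w_def e_def
    by (simp_all only: c cl join_meet_distrib[of _ v v'] meet_join_distrib[of _ u u'])
  then have "(x, x \<sqinter> y) \<in> \<chi>" "(y, x \<sqinter> y) \<in> \<chi>"
    using half[of x y] half[of y x] cl by (simp_all add: meet_comm)
  then show "z \<in> \<chi>" unfolding xy by (rule \<chi>D(4)[OF _ \<chi>D(3)])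
qed

lemma frame_congruence_shift_mem:
  assumes \<theta>: "frame_congruence L \<theta>" "(a, b) \<in> \<theta>" and c: "c \<in> carrier L" "w \<in> carrier L" and "w \<sqsubseteq> b"
  shows "((a \<squnion> c) \<sqinter> w, w) \<in> \<theta>"
proof -
  note \<theta>D = frame_congruenceD[OF \<theta>(1)]
  have ab: "a \<in> carrier L" "b \<in> carrier L" using frame_congruence_closed[OF \<theta>] by auto
  have "((a \<squnion> c) \<sqinter> w, (b \<squnion> c) \<sqinter> w) \<in> \<theta>"
    by (rule \<theta>D(5)[OF frame_congruence_join[OF \<theta> \<theta>D(2)[OF c(1)]] \<theta>D(2)[OF c(2)]])
  moreover have "w \<sqsubseteq> b \<squnion> c"
    using assms(5) ab c by (meson join_closed join_left le_trans)
  ultimately show ?thesis using ab c by (simp add: meet_absorb2)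
qed

lemma congruence_full:
  assumes \<theta>: "frame_congruence L \<theta>" and mem: "(\<bottom>, \<top>) \<in> \<theta>" and c: "x \<in> carrier L" "y \<in> carrier L"
  shows "(x, y) \<in> \<theta>"
proof -
  note \<theta>D = frame_congruenceD[OF \<theta>]
  have bot: "(\<bottom>, z) \<in> \<theta>" if "z \<in> carrier L" for z
    using \<theta>D(5)[OF mem \<theta>D(2)[OF that]] that by (simp add: meet_absorb meet_absorb2)
  show ?thesis by (rule \<theta>D(4)[OF \<theta>D(3)[OF bot[OF c(1)]] bot[OF c(2)]])
qed

lemma top_congruence_frame: "\<top>\<^bsub>congruence_frame L\<^esub> = carrier L \<times> carrier L"
  using C.top_closed C.top_higher[of "carrier L \<times> carrier L"] frame_congruence_full[OF L]
    frame_congruenceD(1)[of L "\<top>\<^bsub>congruence_frame L\<^esub>"] by auto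

lemma bottom_congruence_frame: "\<bottom>\<^bsub>congruence_frame L\<^esub> = Id_on (carrier L)"
  using C.bottom_closed C.bottom_lower[of "Id_on (carrier L)"] frame_congruence_Id[OF L]
    frame_congruenceD(2)[of L "\<bottom>\<^bsub>congruence_frame L\<^esub>"] by (auto simp: Id_on_def)

lemma congruence_eq_top_iff:
  assumes "frame_congruence L \<theta>"
  shows "\<theta> = \<top>\<^bsub>congruence_frame L\<^esub> \<longleftrightarrow> (\<bottom>, \<top>) \<in> \<theta>"
  unfolding top_congruence_frame
  using congruence_full[OF assms] frame_congruenceD(1)[OF assms] by auto

lemma bottom_class_mono:
  assumes \<theta>: "frame_congruence L \<theta>" "(\<bottom>, b) \<in> \<theta>" and "a \<in> carrier L" "a \<sqsubseteq> b"
  shows "(\<bottom>, a) \<in> \<theta>"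
proof -
  note \<theta>D = frame_congruenceD[OF \<theta>(1)]
  have "b \<in> carrier L" using frame_congruence_closed[OF \<theta>] by auto
  then show ?thesis
    using \<theta>D(5)[OF \<theta>(2) \<theta>D(2)[OF assms(3)]] assms(3,4) by (simp add: meet_absorb meet_absorb2)
qed

lemma bottom_class_sup:
  assumes \<theta>: "frame_congruence L \<theta>" and S: "S \<subseteq> carrier L"
  shows "(\<bottom>, \<Squnion>S) \<in> \<theta> \<longleftrightarrow> (\<forall>a\<in>S. (\<bottom>, a) \<in> \<theta>)"
proof
  assume "(\<bottom>, \<Squnion>S) \<in> \<theta>"
  then show "\<forall>a\<in>S. (\<bottom>, a) \<in> \<theta>"
    using S sup_upper[OF S] by (auto intro: bottom_class_mono[OF \<theta>])
next
  assume "\<forall>a\<in>S. (\<bottom>, a) \<in> \<theta>"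
  then have "(\<Squnion>((\<lambda>_. \<bottom>) ` S), \<Squnion>((\<lambda>a. a) ` S)) \<in> \<theta>"
    by (intro frame_congruence_sup[OF \<theta>]) simp
  moreover have "\<Squnion>((\<lambda>_. \<bottom>) ` S) = \<bottom>"
    by (cases "S = {}") (simp_all add: sup_empty image_constant_conv)
  ultimately show "(\<bottom>, \<Squnion>S) \<in> \<theta>" by simp
qed

lemma nabla_Int_delta_subset:
  assumes a: "a \<in> carrier L" and b: "b \<in> carrier L" and \<chi>: "frame_congruence L \<chi>"
    and mem: "(a \<sqinter> b, b) \<in> \<chi>"
  shows "nabla L b \<inter> delta L a \<subseteq> \<chi>"
  unfolding nabla_def delta_def
  by (rule principal_Int_subset) (use assms in \<open>simp_all add: join_absorb meet_absorb\<close>)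

lemma is_complement_nabla_delta:
  assumes a: "a \<in> carrier L"
  shows "is_complement (congruence_frame L) (nabla L a) (delta L a)"
proof -
  let ?J = "nabla L a \<squnion>\<^bsub>congruence_frame L\<^esub> delta L a"
  note cong = nabla_congruence[OF a] delta_congruence[OF a]
  have "nabla L a \<inter> delta L a \<subseteq> Id_on (carrier L)"
    by (rule nabla_Int_delta_subset[OF a a frame_congruence_Id[OF L]])
      (use a in \<open>simp add: meet_absorb Id_on_def\<close>)
  moreover have "Id_on (carrier L) \<subseteq> nabla L a \<inter> delta L a"
    using frame_congruenceD(2)[OF cong(1)] frame_congruenceD(2)[OF cong(2)] by (auto simp: Id_on_def)
  ultimately have meet: "nabla L a \<sqinter>\<^bsub>congruence_frame L\<^esub> delta L a = \<bottom>\<^bsub>congruence_frame L\<^esub>"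
    by (simp add: meet_congruence_frame[OF L cong] bottom_congruence_frame)
  have J: "frame_congruence L ?J" using C.join_closed[of "nabla L a" "delta L a"] cong by simp
  have "nabla L a \<subseteq> ?J" "delta L a \<subseteq> ?J"
    using C.join_left[of "nabla L a" "delta L a"] C.join_right[of "nabla L a" "delta L a"] cong
    by simp_all
  then have "(\<bottom>, \<top>) \<in> ?J"
    using nabla_mem[OF a] delta_mem[OF a] frame_congruenceD(4)[OF J] by blast
  then have "?J = \<top>\<^bsub>congruence_frame L\<^esub>" using congruence_eq_top_iff[OF J] by simp
  then show ?thesis using meet cong by (simp add: is_complement_def)
qed

lemma frame_hom_nabla: "frame_hom L (congruence_frame L) (nabla_map L)"
  unfolding frame_hom_def
proof (intro conjI allI impI ballI L frame_congruence_frame)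
  let ?C = "congruence_frame L"
  show "nabla_map L \<in> carrier L \<rightarrow>\<^sub>E carrier ?C"
    by (simp add: nabla_map_def nabla_congruence)
  show "nabla_map L \<top> = \<top>\<^bsub>?C\<^esub>"
    using congruence_eq_top_iff[OF nabla_congruence[OF top_closed]] nabla_mem[OF top_closed]
    by (simp add: nabla_map_def)
next
  let ?C = "congruence_frame L"
  fix a b assume ab: "a \<in> carrier L" "b \<in> carrier L"
  have cong: "frame_congruence L (nabla L (a \<sqinter> b))" using ab by (simp add: nabla_congruence)
  have "nabla L a \<inter> nabla L b \<subseteq> nabla L (a \<sqinter> b)"
    unfolding nabla_def[of L a] nabla_def[of L b]
    by (rule principal_Int_subset[OF _ _ _ _ _ _ cong])
      (use ab nabla_mem[of "a \<sqinter> b"] in \<open>simp_all add: join_absorb meet_absorb\<close>)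
  moreover have "nabla L (a \<sqinter> b) \<subseteq> nabla L a" "nabla L (a \<sqinter> b) \<subseteq> nabla L b"
    using ab meet_left[OF ab] meet_right[OF ab]
    by (auto simp: nabla_le_iff nabla_congruence
        intro: bottom_class_mono[OF nabla_congruence nabla_mem])
  ultimately show "nabla_map L (a \<sqinter> b) = nabla_map L a \<sqinter>\<^bsub>?C\<^esub> nabla_map L b"
    using ab by (auto simp: nabla_map_def meet_congruence_frame[OF L] nabla_congruence)
next
  let ?C = "congruence_frame L"
  fix S assume S: "S \<subseteq> carrier L"
  have sub: "nabla L ` S \<subseteq> carrier ?C" using S nabla_congruence by auto
  have "nabla L (\<Squnion>S) = \<Squnion>\<^bsub>?C\<^esub>(nabla L ` S)"
  proof (rule C.eq_if_same_upper)
    fix \<theta> assume "\<theta> \<in> carrier ?C"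
    then have \<theta>: "frame_congruence L \<theta>" by simp
    show "le ?C (nabla L (\<Squnion>S)) \<theta> \<longleftrightarrow> le ?C (\<Squnion>\<^bsub>?C\<^esub>(nabla L ` S)) \<theta>"
      unfolding C.sup_le_iff[OF sub \<open>\<theta> \<in> carrier ?C\<close>]
      by (simp add: nabla_le_iff[OF \<theta>] bottom_class_sup[OF \<theta> S])
  qed (use S C.sup_closed[OF sub] in \<open>simp_all add: nabla_congruence\<close>)
  moreover have "nabla_map L ` S = nabla L ` S"
    using S by (intro image_cong) (auto simp: nabla_map_def)
  ultimately show "nabla_map L (\<Squnion>S) = \<Squnion>\<^bsub>?C\<^esub>(nabla_map L ` S)"
    using S by (simp add: nabla_map_def)
qed

text \<open>The pairs \<open>(a, b)\<close> with \<open>a \<sqsubseteq> b\<close> suffice, since \<open>(x, y)\<close> follows from \<open>(x \<sqinter> y, x)\<close> and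
  \<open>(x \<sqinter> y, y)\<close>. The restriction matters because only such principal congruences have the form
  \<open>\<nabla>\<^sub>b \<sqinter> \<Delta>\<^sub>a\<close>.\<close>

lemma congruence_eq_sup_principal:
  assumes \<theta>: "frame_congruence L \<theta>"
  shows "\<theta> = \<Squnion>\<^bsub>congruence_frame L\<^esub>
    ((\<lambda>(a, b). generated_congruence L {(a, b)}) ` {(a, b) \<in> \<theta>. a \<sqsubseteq> b})"
    (is "_ = \<Squnion>\<^bsub>?C\<^esub>?S")
proof
  note closed = frame_congruence_closed[OF \<theta>] and \<theta>D = frame_congruenceD[OF \<theta>]
  have S: "?S \<subseteq> carrier ?C" using closed by (auto simp: principal_congruence)
  have sup: "frame_congruence L (\<Squnion>\<^bsub>?C\<^esub>?S)" using C.sup_closed[OF S] by simp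
  show "\<Squnion>\<^bsub>?C\<^esub>?S \<subseteq> \<theta>"
  proof -
    have "\<chi> \<subseteq> \<theta>" if "\<chi> \<in> ?S" for \<chi>
    proof -
      obtain a b where "\<chi> = generated_congruence L {(a, b)}" "(a, b) \<in> \<theta>" using \<open>\<chi> \<in> ?S\<close> by auto
      then show ?thesis by (simp add: generated_congruence_le_iff[OF \<theta>])
    qed
    then show ?thesis using C.sup_least[OF S, of \<theta>] \<theta> by simp
  qed
  have mem: "(a, b) \<in> \<Squnion>\<^bsub>?C\<^esub>?S" if "(a, b) \<in> \<theta>" "a \<sqsubseteq> b" for a b
  proof -
    have "generated_congruence L {(a, b)} \<in> ?S" using that by force
    then have "generated_congruence L {(a, b)} \<subseteq> \<Squnion>\<^bsub>?C\<^esub>?S" using C.sup_upper[OF S] by simp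
    then have "{(a, b)} \<subseteq> \<Squnion>\<^bsub>?C\<^esub>?S" by (rule generated_congruence_le_iff[OF sup, THEN iffD1])
    then show ?thesis by blast
  qed
  show "\<theta> \<subseteq> \<Squnion>\<^bsub>?C\<^esub>?S"
  proof (rule subrelI)
    fix x y assume xy: "(x, y) \<in> \<theta>"
    then have c: "x \<in> carrier L" "y \<in> carrier L" using closed by auto
    have y: "(x \<sqinter> y, y) \<in> \<theta>"
      using \<theta>D(5)[OF xy \<theta>D(2)[OF c(2)]] c by (simp add: meet_absorb)
    have x: "(x \<sqinter> y, x) \<in> \<theta>" using \<theta>D(4)[OF y \<theta>D(3)[OF xy]] .
    have "(x \<sqinter> y, y) \<in> \<Squnion>\<^bsub>?C\<^esub>?S" "(x \<sqinter> y, x) \<in> \<Squnion>\<^bsub>?C\<^esub>?S"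
      using mem[OF y] mem[OF x] c meet_left meet_right by simp_all
    then show "(x, y) \<in> \<Squnion>\<^bsub>?C\<^esub>?S" using frame_congruenceD(3,4)[OF sup] by blast
  qed
qed

lemma principal_eq_nabla_delta:
  assumes a: "a \<in> carrier L" and b: "b \<in> carrier L" and le: "a \<sqsubseteq> b"
  shows "generated_congruence L {(a, b)} =
    nabla L b \<sqinter>\<^bsub>congruence_frame L\<^esub> delta L a"
proof -
  have mem: "(a, b) \<in> generated_congruence L {(a, b)}"
    using generated_congruence_le_iff[OF principal_congruence[OF a b], of "{(a, b)}"] by simp
  have "nabla L b \<inter> delta L a \<subseteq> generated_congruence L {(a, b)}"
    by (rule nabla_Int_delta_subset[OF a b principal_congruence[OF a b]])
      (use a b le mem in \<open>simp add: meet_absorb\<close>)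
  moreover have "(a, b) \<in> nabla L b"
    using frame_congruence_join[OF nabla_congruence[OF b] nabla_mem[OF b]
        frame_congruenceD(2)[OF nabla_congruence[OF b] a]] a b le
    by (simp add: join_absorb join_absorb2)
  then have "generated_congruence L {(a, b)} \<subseteq> nabla L b"
    by (simp add: generated_congruence_le_iff nabla_congruence b)
  moreover have "(a, b) \<in> delta L a"
    using frame_congruenceD(5)[OF delta_congruence[OF a] delta_mem[OF a]
        frame_congruenceD(2)[OF delta_congruence[OF a] b]] a b le
    by (simp add: meet_absorb meet_absorb2)
  then have "generated_congruence L {(a, b)} \<subseteq> delta L a"
    by (simp add: generated_congruence_le_iff delta_congruence a)
  ultimately show ?thesis
    by (auto simp: meet_congruence_frame[OF L nabla_congruence[OF b] delta_congruence[OF a]])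
qed

end

section \<open>The congruence functor\<close>

lemma is_complement_frame_hom:
  assumes f: "frame_hom L M f" and a: "a \<in> carrier L" and b: "is_complement L a b"
  shows "is_complement M (f a) (f b)"
proof -
  have b': "b \<in> carrier L" using b by (simp add: is_complement_def)
  show ?thesis
    using b frame_homD(3-5)[OF f] frame_hom_join[OF f a b'] frame_hom_bottom[OF f] a b'
    unfolding is_complement_def by metis
qed

text \<open>Complements are unique, so the value of a homomorphism at \<open>\<Delta>\<^sub>a\<close> is determined by its value
  at \<open>\<nabla>\<^sub>a\<close>, and every congruence is a join of congruences \<open>\<nabla>\<^sub>b \<sqinter> \<Delta>\<^sub>a\<close>.\<close>

lemma congruence_frame_hom_unique:
  assumes L: "frame L" and g: "frame_hom (congruence_frame L) N g"
    and h: "frame_hom (congruence_frame L) N h"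
    and eq: "\<And>a. a \<in> carrier L \<Longrightarrow> g (nabla L a) = h (nabla L a)"
  shows "g = h"
proof (rule extensionalityI[OF frame_homD(7)[OF g] frame_homD(7)[OF h]])
  interpret frame L by (rule L)
  let ?C = "congruence_frame L"
  note N = frame_homD(2)[OF g]
  have delta: "g (delta L a) = h (delta L a)" if a: "a \<in> carrier L" for a
  proof (rule complement_unique[OF N])
    have "nabla L a \<in> carrier ?C" using nabla_congruence[OF L a] by simp
    then show "is_complement N (g (nabla L a)) (g (delta L a))"
      "is_complement N (g (nabla L a)) (h (delta L a))" "g (nabla L a) \<in> carrier N"
      using is_complement_frame_hom[OF g _ is_complement_nabla_delta[OF L a]]
        is_complement_frame_hom[OF h _ is_complement_nabla_delta[OF L a]] frame_homD(3)[OF h]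
      by (simp_all add: eq[OF a])
  qed
  fix \<theta> assume "\<theta> \<in> carrier ?C"
  then have \<theta>: "frame_congruence L \<theta>" by simp
  let ?R = "{(a, b) \<in> \<theta>. le L a b}"
  let ?p = "\<lambda>(a, b). generated_congruence L {(a, b)}"
  have sub: "?p ` ?R \<subseteq> carrier ?C"
    using frame_congruence_closed[OF \<theta>] by (auto simp: principal_congruence[OF L])
  have "g (?p r) = h (?p r)" if r: "r \<in> ?R" for r
  proof -
    obtain a b where ab: "r = (a, b)" "a \<in> carrier L" "b \<in> carrier L" "a \<sqsubseteq>\<^bsub>L\<^esub> b"
      using r frame_congruence_closed[OF \<theta>] by auto
    then show ?thesis
      using nabla_congruence[OF L] delta_congruence[OF L]
      by (simp add: principal_eq_nabla_delta[OF L] frame_homD(5)[OF g] frame_homD(5)[OF h]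
          eq delta)
  qed
  then have "g ` ?p ` ?R = h ` ?p ` ?R" by (simp only: image_image cong: image_cong)
  then have "g (\<Squnion>\<^bsub>?C\<^esub>(?p ` ?R)) = h (\<Squnion>\<^bsub>?C\<^esub>(?p ` ?R))"
    by (simp only: frame_homD(6)[OF g sub] frame_homD(6)[OF h sub])
  then show "g \<theta> = h \<theta>"
    using congruence_eq_sup_principal[OF L \<theta>] by simp
qed

text \<open>The explicit form of the functor \<open>\<C>\<close> on morphisms: left adjoint to taking inverse images of
  congruences along \<open>f \<times> f\<close>.\<close>

definition congruence_image ::
    "'a gorder \<Rightarrow> 'b gorder \<Rightarrow> ('a \<Rightarrow> 'b) \<Rightarrow> ('a \<times> 'a) set \<Rightarrow> ('b \<times> 'b) set" where
  "congruence_image L M f =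
     (\<lambda>\<theta>\<in>carrier (congruence_frame L). generated_congruence M ((\<lambda>(x, y). (f x, f y)) ` \<theta>))"

lemma (in frame) meet_sup_sup_le:
  assumes S: "S \<subseteq> carrier L" and T: "T \<subseteq> carrier L" and z: "z \<in> carrier L"
    and le: "\<And>s t. \<lbrakk>s \<in> S; t \<in> T\<rbrakk> \<Longrightarrow> s \<sqinter> t \<sqsubseteq> z"
  shows "\<Squnion>S \<sqinter> \<Squnion>T \<sqsubseteq> z"
proof -
  have step: "a \<sqinter> \<Squnion>U \<sqsubseteq> z"
    if "a \<in> carrier L" "U \<subseteq> carrier L" "\<And>u. u \<in> U \<Longrightarrow> a \<sqinter> u \<sqsubseteq> z" for a U
    unfolding meet_sup_distrib[OF that(1,2)]
    using that z by (intro sup_least) auto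
  have "\<Squnion>T \<sqinter> s \<sqsubseteq> z" if "s \<in> S" for s
    using step[of s T] S T le that by (auto simp: meet_comm[of L _ s])
  then show ?thesis
    using step[of "\<Squnion>T" S] S T by (simp add: meet_comm[of L "\<Squnion>S"])
qed

context
  fixes L :: "'a gorder" and M :: "'b gorder" and f
  assumes f: "frame_hom L M f"
begin

interpretation L: frame L using f by (rule frame_homD)
interpretation M: frame M using f by (rule frame_homD)
interpretation CL: frame "congruence_frame L" by (rule frame_congruence_frame[OF L.frame_axioms])
interpretation CM: frame "congruence_frame M" by (rule frame_congruence_frame[OF M.frame_axioms])

lemma congruence_image_closed:
  assumes "frame_congruence L \<theta>"
  shows "frame_congruence M (congruence_image L M f \<theta>)"
  using assms frame_congruenceD(1)[OF assms] frame_homD(3)[OF f]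
  by (auto simp: congruence_image_def intro!: frame_congruence_generated[OF M.frame_axioms])

lemma congruence_image_le_iff:
  assumes \<theta>: "frame_congruence L \<theta>" and \<psi>: "frame_congruence M \<psi>"
  shows "congruence_image L M f \<theta> \<subseteq> \<psi> \<longleftrightarrow>
    \<theta> \<subseteq> {(x, y) \<in> carrier L \<times> carrier L. (f x, f y) \<in> \<psi>}"
  using \<theta> frame_congruenceD(1)[OF \<theta>]
  by (auto simp: congruence_image_def generated_congruence_le_iff[OF \<psi>])

lemma congruence_image_mem:
  assumes \<theta>: "frame_congruence L \<theta>" and "(x, y) \<in> \<theta>"
  shows "(f x, f y) \<in> congruence_image L M f \<theta>"
  using congruence_image_le_iff[OF \<theta> congruence_image_closed[OF \<theta>]] assms(2) by blast

lemma congruence_image_principal: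
  assumes a: "a \<in> carrier L" and b: "b \<in> carrier L"
  shows "congruence_image L M f (generated_congruence L {(a, b)}) =
    generated_congruence M {(f a, f b)}"
proof (rule CM.eq_if_same_upper)
  have cong: "frame_congruence L (generated_congruence L {(a, b)})"
    by (rule principal_congruence[OF L.frame_axioms a b])
  then show "congruence_image L M f (generated_congruence L {(a, b)}) \<in> carrier (congruence_frame M)"
    by (simp add: congruence_image_closed)
  show "generated_congruence M {(f a, f b)} \<in> carrier (congruence_frame M)"
    using principal_congruence[OF M.frame_axioms] a b frame_homD(3)[OF f] by simp
  fix \<psi> assume "\<psi> \<in> carrier (congruence_frame M)"
  then have \<psi>: "frame_congruence M \<psi>" by simp
  show "le (congruence_frame M) (congruence_image L M f (generated_congruence L {(a, b)})) \<psi> \<longleftrightarrow>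
      le (congruence_frame M) (generated_congruence M {(f a, f b)}) \<psi>"
    using a b
    by (simp only: le_congruence_frame congruence_image_le_iff[OF cong \<psi>]
        generated_congruence_le_iff[OF \<psi>]
        generated_congruence_le_iff[OF frame_congruence_hom_vimage[OF f \<psi>]]) simp
qed

lemma congruence_image_sup:
  assumes S: "S \<subseteq> carrier (congruence_frame L)"
  shows "congruence_image L M f (\<Squnion>\<^bsub>congruence_frame L\<^esub>S) =
    \<Squnion>\<^bsub>congruence_frame M\<^esub>(congruence_image L M f ` S)"
proof (rule CM.eq_if_same_upper)
  have cong: "frame_congruence L (\<Squnion>\<^bsub>congruence_frame L\<^esub>S)" using CL.sup_closed[OF S] by simp
  have sub: "congruence_image L M f ` S \<subseteq> carrier (congruence_frame M)"
    using S congruence_image_closed by auto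
  show "congruence_image L M f (\<Squnion>\<^bsub>congruence_frame L\<^esub>S) \<in> carrier (congruence_frame M)"
    using congruence_image_closed[OF cong] by simp
  show "\<Squnion>\<^bsub>congruence_frame M\<^esub>(congruence_image L M f ` S) \<in> carrier (congruence_frame M)"
    by (rule CM.sup_closed[OF sub])
  fix \<psi> assume \<psi>': "\<psi> \<in> carrier (congruence_frame M)"
  then have \<psi>: "frame_congruence M \<psi>" by simp
  let ?P = "{(x, y) \<in> carrier L \<times> carrier L. (f x, f y) \<in> \<psi>}"
  have P: "?P \<in> carrier (congruence_frame L)"
    using frame_congruence_hom_vimage[OF f \<psi>] by simp
  have "congruence_image L M f (\<Squnion>\<^bsub>congruence_frame L\<^esub>S) \<subseteq> \<psi> \<longleftrightarrow> (\<forall>\<theta>\<in>S. \<theta> \<subseteq> ?P)"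
    using congruence_image_le_iff[OF cong \<psi>] CL.sup_le_iff[OF S P] by simp
  also have "\<dots> \<longleftrightarrow> (\<forall>\<theta>\<in>S. congruence_image L M f \<theta> \<subseteq> \<psi>)"
  proof (rule ball_cong[OF refl])
    fix \<theta> assume "\<theta> \<in> S"
    then have "frame_congruence L \<theta>" using S by auto
    from congruence_image_le_iff[OF this \<psi>]
    show "\<theta> \<subseteq> ?P \<longleftrightarrow> congruence_image L M f \<theta> \<subseteq> \<psi>" by (rule sym)
  qed
  finally show "le (congruence_frame M) (congruence_image L M f (\<Squnion>\<^bsub>congruence_frame L\<^esub>S)) \<psi> \<longleftrightarrow>
      le (congruence_frame M) (\<Squnion>\<^bsub>congruence_frame M\<^esub>(congruence_image L M f ` S)) \<psi>"
    unfolding CM.sup_le_iff[OF sub \<psi>'] by simp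
qed

text \<open>Only preservation of binary meets is not formal. By distributivity it reduces to principal
  congruences \<open>\<langle>(a, b)\<rangle>\<close> and \<open>\<langle>(c, d)\<rangle>\<close>, and the pair that generates their intersection is
  a lattice expression in \<open>a, b, c, d\<close>, so it is preserved by \<open>f\<close>.\<close>

lemma congruence_image_Int:
  assumes \<theta>: "frame_congruence L \<theta>" and \<phi>: "frame_congruence L \<phi>"
  shows "congruence_image L M f (\<theta> \<inter> \<phi>) = congruence_image L M f \<theta> \<inter> congruence_image L M f \<phi>"
proof
  have int: "frame_congruence L (\<theta> \<inter> \<phi>)"
    using frame_congruence_Inter[OF L.frame_axioms, of "{\<theta>, \<phi>}"] \<theta> \<phi> by auto
  let ?\<chi> = "congruence_image L M f (\<theta> \<inter> \<phi>)"
  have \<chi>: "frame_congruence M ?\<chi>" by (rule congruence_image_closed[OF int])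
  have "\<theta> \<inter> \<phi> \<subseteq> {(x, y) \<in> carrier L \<times> carrier L. (f x, f y) \<in> congruence_image L M f \<theta>}"
    "\<theta> \<inter> \<phi> \<subseteq> {(x, y) \<in> carrier L \<times> carrier L. (f x, f y) \<in> congruence_image L M f \<phi>}"
    using congruence_image_mem[OF \<theta>] congruence_image_mem[OF \<phi>] frame_congruenceD(1)[OF \<theta>]
    by auto
  then show "?\<chi> \<subseteq> congruence_image L M f \<theta> \<inter> congruence_image L M f \<phi>"
    by (simp add: congruence_image_le_iff[OF int] congruence_image_closed \<theta> \<phi>)
  let ?R = "\<lambda>\<theta>. {(a, b) \<in> \<theta>. le L a b}"
  let ?p = "\<lambda>(a, b). generated_congruence M {(f a, f b)}"
  have image: "congruence_image L M f \<theta> = \<Squnion>\<^bsub>congruence_frame M\<^esub>(?p ` ?R \<theta>) \<and>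
      ?p ` ?R \<theta> \<subseteq> carrier (congruence_frame M)"
    if \<theta>: "frame_congruence L \<theta>" for \<theta>
  proof
    let ?q = "\<lambda>(a, b). generated_congruence L {(a, b)}"
    have "?q ` ?R \<theta> \<subseteq> carrier (congruence_frame L)"
      using frame_congruence_closed[OF \<theta>] by (auto simp: principal_congruence[OF L.frame_axioms])
    from congruence_image_sup[OF this]
    have "congruence_image L M f \<theta> = \<Squnion>\<^bsub>congruence_frame M\<^esub>(congruence_image L M f ` ?q ` ?R \<theta>)"
      using congruence_eq_sup_principal[OF L.frame_axioms \<theta>] by simp
    also have "congruence_image L M f ` ?q ` ?R \<theta> = ?p ` ?R \<theta>"
      unfolding image_image using frame_congruence_closed[OF \<theta>]
      by (intro image_cong refl) (auto simp: congruence_image_principal)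
    finally show "congruence_image L M f \<theta> = \<Squnion>\<^bsub>congruence_frame M\<^esub>(?p ` ?R \<theta>)" .
    show "?p ` ?R \<theta> \<subseteq> carrier (congruence_frame M)"
      using frame_congruence_closed[OF \<theta>] frame_homD(3)[OF f]
      by (auto simp: principal_congruence[OF M.frame_axioms])
  qed
  have "le (congruence_frame M) (s \<sqinter>\<^bsub>congruence_frame M\<^esub> t) ?\<chi>"
    if "s \<in> ?p ` ?R \<theta>" "t \<in> ?p ` ?R \<phi>" for s t
  proof -
    obtain a b where ab: "(a, b) \<in> \<theta>" "a \<sqsubseteq>\<^bsub>L\<^esub> b" "s = generated_congruence M {(f a, f b)}"
      using \<open>s \<in> _\<close> by auto
    obtain c d where cd: "(c, d) \<in> \<phi>" "c \<sqsubseteq>\<^bsub>L\<^esub> d" "t = generated_congruence M {(f c, f d)}"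
      using \<open>t \<in> _\<close> by auto
    have cl: "a \<in> carrier L" "b \<in> carrier L" "c \<in> carrier L" "d \<in> carrier L"
      using frame_congruence_closed[OF \<theta> ab(1)] frame_congruence_closed[OF \<phi> cd(1)] by auto
    note fcl = cl[THEN frame_homD(3)[OF f]]
    let ?w = "b \<sqinter>\<^bsub>L\<^esub> d" and ?e = "a \<squnion>\<^bsub>L\<^esub> c"
    have "(?e \<sqinter>\<^bsub>L\<^esub> ?w, ?w) \<in> \<theta>"
      using cl L.meet_left[of b d]
      by (intro frame_congruence_shift_mem[OF L.frame_axioms \<theta> ab(1)]) simp_all
    moreover have "((c \<squnion>\<^bsub>L\<^esub> a) \<sqinter>\<^bsub>L\<^esub> ?w, ?w) \<in> \<phi>"
      using cl L.meet_right[of b d]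
      by (intro frame_congruence_shift_mem[OF L.frame_axioms \<phi> cd(1)]) simp_all
    ultimately have "(?e \<sqinter>\<^bsub>L\<^esub> ?w, ?w) \<in> \<theta> \<inter> \<phi>" by (simp add: join_comm[of L c a])
    from congruence_image_mem[OF int this]
    have "((f a \<squnion>\<^bsub>M\<^esub> f c) \<sqinter>\<^bsub>M\<^esub> (f b \<sqinter>\<^bsub>M\<^esub> f d), f b \<sqinter>\<^bsub>M\<^esub> f d) \<in> ?\<chi>"
      using cl by (simp add: frame_homD(5)[OF f] frame_hom_join[OF f])
    then have "s \<inter> t \<subseteq> ?\<chi>"
      unfolding ab(3) cd(3)
      by (intro principal_Int_subset[OF M.frame_axioms fcl _ _ \<chi>] frame_hom_mono[OF f] cl ab cd)
    then show ?thesis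
      using fcl unfolding ab(3) cd(3)
      by (simp add: meet_congruence_frame[OF M.frame_axioms] principal_congruence[OF M.frame_axioms])
  qed
  then have "le (congruence_frame M)
      (congruence_image L M f \<theta> \<sqinter>\<^bsub>congruence_frame M\<^esub> congruence_image L M f \<phi>) ?\<chi>"
    using image[OF \<theta>] image[OF \<phi>] \<chi>
      CM.meet_sup_sup_le[of "?p ` ?R \<theta>" "?p ` ?R \<phi>" ?\<chi>] by simp
  then show "congruence_image L M f \<theta> \<inter> congruence_image L M f \<phi> \<subseteq> ?\<chi>"
    by (simp add: meet_congruence_frame[OF M.frame_axioms] congruence_image_closed \<theta> \<phi>)
qed

lemma frame_hom_congruence_image:
  "frame_hom (congruence_frame L) (congruence_frame M) (congruence_image L M f)"
  unfolding frame_hom_def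
proof (intro conjI allI impI ballI CL.frame_axioms CM.frame_axioms)
  show "congruence_image L M f \<in> carrier (congruence_frame L) \<rightarrow>\<^sub>E carrier (congruence_frame M)"
    using congruence_image_closed by (auto simp: congruence_image_def)
  have full: "frame_congruence L \<top>\<^bsub>congruence_frame L\<^esub>" using CL.top_closed by simp
  have "(f \<bottom>\<^bsub>L\<^esub>, f \<top>\<^bsub>L\<^esub>) \<in> congruence_image L M f \<top>\<^bsub>congruence_frame L\<^esub>"
    by (rule congruence_image_mem[OF full]) (simp add: top_congruence_frame[OF L.frame_axioms])
  then show "congruence_image L M f \<top>\<^bsub>congruence_frame L\<^esub> = \<top>\<^bsub>congruence_frame M\<^esub>"
    using congruence_eq_top_iff[OF M.frame_axioms congruence_image_closed[OF full]]
    by (simp add: frame_hom_bottom[OF f] frame_homD(4)[OF f])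
next
  fix \<theta> \<phi> assume "\<theta> \<in> carrier (congruence_frame L)" "\<phi> \<in> carrier (congruence_frame L)"
  then show "congruence_image L M f (\<theta> \<sqinter>\<^bsub>congruence_frame L\<^esub> \<phi>) =
      congruence_image L M f \<theta> \<sqinter>\<^bsub>congruence_frame M\<^esub> congruence_image L M f \<phi>"
    by (simp add: meet_congruence_frame[OF L.frame_axioms] meet_congruence_frame[OF M.frame_axioms]
        congruence_image_closed congruence_image_Int)
qed (rule congruence_image_sup)

lemma congruence_map_eq_image: "congruence_map L M f = congruence_image L M f"
  unfolding congruence_map_def
proof (rule the_equality)
  have nabla: "congruence_image L M f (nabla L a) = nabla M (f a)" if "a \<in> carrier L" for a
    using that by (simp add: nabla_def congruence_image_principal frame_hom_bottom[OF f])
  then show "frame_hom (congruence_frame L) (congruence_frame M) (congruence_image L M f) \<and>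
      (\<forall>a\<in>carrier L. congruence_image L M f (nabla L a) = nabla M (f a))"
    using frame_hom_congruence_image by blast
  show "g = congruence_image L M f"
    if "frame_hom (congruence_frame L) (congruence_frame M) g \<and>
      (\<forall>a\<in>carrier L. g (nabla L a) = nabla M (f a))" for g
    using that frame_hom_congruence_image nabla
    by (intro congruence_frame_hom_unique[OF L.frame_axioms]) auto
qed

lemma frame_hom_congruence_map:
  "frame_hom (congruence_frame L) (congruence_frame M) (congruence_map L M f)"
  unfolding congruence_map_eq_image by (rule frame_hom_congruence_image)

lemma congruence_map_nabla:
  assumes "a \<in> carrier L"
  shows "congruence_map L M f (nabla L a) = nabla M (f a)"
  unfolding congruence_map_eq_image nabla_def
  using assms by (simp add: congruence_image_principal frame_hom_bottom[OF f])

end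

lemma congruence_map_id:
  assumes L: "frame L"
  shows "congruence_map L L (\<lambda>x\<in>carrier L. x) = (\<lambda>\<theta>\<in>carrier (congruence_frame L). \<theta>)"
  using congruence_map_nabla[OF frame_hom_id[OF L]] nabla_congruence[OF L]
  by (intro congruence_frame_hom_unique[OF L frame_hom_congruence_map[OF frame_hom_id[OF L]]
        frame_hom_id[OF frame_congruence_frame[OF L]]]) simp

lemma congruence_map_compose:
  assumes f: "frame_hom L M f" and g: "frame_hom M N g"
  shows "congruence_map L N (compose (carrier L) g f) =
    compose (carrier (congruence_frame L)) (congruence_map M N g) (congruence_map L M f)"
  using congruence_map_nabla[OF frame_hom_compose[OF f g]] congruence_map_nabla[OF f]
    congruence_map_nabla[OF g] frame_homD(3)[OF f] nabla_congruence[OF frame_homD(1)[OF f]]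
  by (intro congruence_frame_hom_unique[OF frame_homD(1)[OF f]
        frame_hom_congruence_map[OF frame_hom_compose[OF f g]]
        frame_hom_compose[OF frame_hom_congruence_map[OF f] frame_hom_congruence_map[OF g]]])
    (simp add: compose_def)

lemma nabla_natural:
  assumes f: "frame_hom L M f"
  shows "compose (carrier L) (congruence_map L M f) (nabla_map L) = compose (carrier L) (nabla_map M) f"
  unfolding compose_def
  by (rule restrict_ext)
    (simp add: nabla_map_def frame_homD(1-3)[OF f] congruence_map_nabla[OF f])

section \<open>Prime congruences\<close>

definition point_congruence :: "'a gorder \<Rightarrow> 'a \<Rightarrow> ('a \<times> 'a) set" where
  "point_congruence L p = {(x, y) \<in> carrier L \<times> carrier L. x \<sqsubseteq>\<^bsub>L\<^esub> p \<longleftrightarrow> y \<sqsubseteq>\<^bsub>L\<^esub> p}"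

text \<open>The image of the homomorphism \<open>a \<mapsto> \<nabla>\<^sub>a\<close> under the spectrum functor: on primes its value at
  \<open>\<theta>\<close> is the largest element of the class of \<open>\<bottom>\<close>.\<close>

definition congruence_point :: "'a gorder \<Rightarrow> ('a \<times> 'a) set \<Rightarrow> 'a" where
  "congruence_point L = spectrum_map L (congruence_frame L) (nabla_map L)"

text \<open>The bijection of the prime congruences with the points of \<open>L\<close> carries the spectral topology of
  \<open>L\<close> to this one. It is coarser than the spectral topology of the congruence frame, which turns out
  to be its Skula topology.\<close>

definition congruence_point_space :: "'a gorder \<Rightarrow> ('a \<times> 'a) set topology" where
  "congruence_point_space L =
     pullback_topology (prime_elements (congruence_frame L)) (congruence_point L) (spectrum L)"

context
  fixes L :: "'a gorder" (structure)
  assumes L: "frame L"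
begin

interpretation frame L by (rule L)
interpretation C: frame "congruence_frame L" by (rule frame_congruence_frame[OF L])

lemma point_congruence_congruence:
  assumes p: "p \<in> prime_elements L"
  shows "frame_congruence L (point_congruence L p)"
proof (rule frame_congruenceI)
  have pc: "p \<in> carrier L" by (rule prime_closed[OF L p])
  show "(a \<sqinter> c, b \<sqinter> d) \<in> point_congruence L p"
    if "(a, b) \<in> point_congruence L p" "(c, d) \<in> point_congruence L p" for a b c d
    using that by (simp add: point_congruence_def meet_le_prime_iff[OF L p])
  show "(\<Squnion>(fst ` R), \<Squnion>(snd ` R)) \<in> point_congruence L p" if R: "R \<subseteq> point_congruence L p" for R
  proof -
    have sub: "fst ` R \<subseteq> carrier L" "snd ` R \<subseteq> carrier L"
      using R by (auto simp: point_congruence_def)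
    have "(\<forall>r\<in>R. fst r \<sqsubseteq> p) \<longleftrightarrow> (\<forall>r\<in>R. snd r \<sqsubseteq> p)"
      using R by (intro ball_cong refl) (auto simp: point_congruence_def)
    then show ?thesis
      using sub by (simp add: point_congruence_def sup_le_iff pc)
  qed
qed (auto simp: point_congruence_def)

lemma bottom_point_congruence:
  assumes p: "p \<in> prime_elements L" and a: "a \<in> carrier L"
  shows "(\<bottom>, a) \<in> point_congruence L p \<longleftrightarrow> a \<sqsubseteq> p"
  using a prime_closed[OF L p] by (simp add: point_congruence_def)

lemma not_le_point_congruence:
  assumes \<theta>: "frame_congruence L \<theta>" and not_le: "\<not> \<theta> \<subseteq> point_congruence L p"
  obtains a b where "(a, b) \<in> \<theta>" "a \<in> carrier L" "b \<in> carrier L" "a \<sqsubseteq> p" "\<not> b \<sqsubseteq> p"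
proof -
  obtain a b where ab: "(a, b) \<in> \<theta>" "(a, b) \<notin> point_congruence L p" using not_le by auto
  note cl = frame_congruence_closed[OF \<theta> ab(1)]
  have "a \<sqsubseteq> p \<and> \<not> b \<sqsubseteq> p \<or> b \<sqsubseteq> p \<and> \<not> a \<sqsubseteq> p"
    using ab(2) cl by (auto simp: point_congruence_def)
  then show thesis using that ab(1) frame_congruenceD(3)[OF \<theta> ab(1)] cl by metis
qed

text \<open>If \<open>\<theta>\<close> and \<open>\<phi>\<close> contain pairs \<open>(a, b)\<close> and \<open>(c, d)\<close> with \<open>a\<close> and \<open>c\<close> below \<open>p\<close> but \<open>b\<close> and
  \<open>d\<close> not, then \<open>((a \<squnion> c) \<sqinter> (b \<sqinter> d), b \<sqinter> d)\<close> is such a pair in \<open>\<theta> \<inter> \<phi>\<close>.\<close>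

lemma point_congruence_prime:
  assumes p: "p \<in> prime_elements L"
  shows "point_congruence L p \<in> prime_elements (congruence_frame L)"
proof (rule prime_elementsI[OF _ _ C.frame_axioms])
  note cong = point_congruence_congruence[OF p]
  show "point_congruence L p \<in> carrier (congruence_frame L)" using cong by simp
  have "(\<bottom>, \<top>) \<notin> point_congruence L p"
    using bottom_point_congruence[OF p top_closed] prime_not_top[OF L p] by simp
  then show "\<not> le (congruence_frame L) \<top>\<^bsub>congruence_frame L\<^esub> (point_congruence L p)"
    unfolding top_congruence_frame[OF L] by auto
next
  have pc: "p \<in> carrier L" by (rule prime_closed[OF L p])
  fix \<theta> \<phi>
  assume "\<theta> \<in> carrier (congruence_frame L)" "\<phi> \<in> carrier (congruence_frame L)"
    and le: "le (congruence_frame L) (\<theta> \<sqinter>\<^bsub>congruence_frame L\<^esub> \<phi>) (point_congruence L p)"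
    and n\<theta>: "\<not> le (congruence_frame L) \<theta> (point_congruence L p)"
  then have \<theta>: "frame_congruence L \<theta>" and \<phi>: "frame_congruence L \<phi>" by simp_all
  show "le (congruence_frame L) \<phi> (point_congruence L p)"
  proof (rule ccontr)
    assume n\<phi>: "\<not> le (congruence_frame L) \<phi> (point_congruence L p)"
    obtain a b where ab: "(a, b) \<in> \<theta>" "a \<in> carrier L" "b \<in> carrier L" "a \<sqsubseteq> p" "\<not> b \<sqsubseteq> p"
      using not_le_point_congruence[OF \<theta>, of p] n\<theta> by auto
    obtain c d where cd: "(c, d) \<in> \<phi>" "c \<in> carrier L" "d \<in> carrier L" "c \<sqsubseteq> p" "\<not> d \<sqsubseteq> p"
      using not_le_point_congruence[OF \<phi>, of p] n\<phi> by auto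
    have w: "b \<sqinter> d \<in> carrier L" using ab cd by simp
    have "((a \<squnion> c) \<sqinter> (b \<sqinter> d), b \<sqinter> d) \<in> \<theta>"
      by (rule frame_congruence_shift_mem[OF L \<theta> ab(1) cd(2) w meet_left[OF ab(3) cd(3)]])
    moreover have "((c \<squnion> a) \<sqinter> (b \<sqinter> d), b \<sqinter> d) \<in> \<phi>"
      by (rule frame_congruence_shift_mem[OF L \<phi> cd(1) ab(2) w meet_right[OF ab(3) cd(3)]])
    ultimately have "((a \<squnion> c) \<sqinter> (b \<sqinter> d), b \<sqinter> d) \<in> point_congruence L p"
      using le by (auto simp: meet_congruence_frame[OF L \<theta> \<phi>] join_comm[of L c a])
    moreover have "(a \<squnion> c) \<sqinter> (b \<sqinter> d) \<sqsubseteq> p"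
      using meet_le_prime_iff[OF L p _ w] ab cd join_le_iff[of a c p] pc by simp
    moreover have "\<not> b \<sqinter> d \<sqsubseteq> p"
      using meet_le_prime_iff[OF L p ab(3) cd(3)] ab(5) cd(5) by simp
    ultimately show False by (simp add: point_congruence_def)
  qed
qed

context
  fixes \<theta>
  assumes \<theta>: "\<theta> \<in> prime_elements (congruence_frame L)"
begin

lemma prime_congruence: "frame_congruence L \<theta>"
  using prime_closed[OF C.frame_axioms \<theta>] by simp

lemma nabla_le_prime_iff:
  "a \<in> carrier L \<Longrightarrow> le (congruence_frame L) (nabla L a) \<theta> \<longleftrightarrow> a \<sqsubseteq> congruence_point L \<theta>"
  using spectrum_map_iff[OF frame_hom_nabla[OF L] \<theta>, of a]
  by (simp add: congruence_point_def nabla_map_def)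

lemma delta_le_prime_iff:
  assumes "a \<in> carrier L"
  shows "le (congruence_frame L) (delta L a) \<theta> \<longleftrightarrow> \<not> a \<sqsubseteq> congruence_point L \<theta>"
  using prime_complement[OF C.frame_axioms \<theta> _ is_complement_nabla_delta[OF L assms]]
    nabla_congruence[OF L assms] nabla_le_prime_iff[OF assms] by simp

lemma congruence_point_prime: "congruence_point L \<theta> \<in> prime_elements L"
  unfolding congruence_point_def by (rule spectrum_map_prime[OF frame_hom_nabla[OF L] \<theta>])

text \<open>A prime congruence contains \<open>\<nabla>\<^sub>a\<close> or \<open>\<Delta>\<^sub>a\<close>, so it identifies \<open>a\<close> with \<open>\<bottom>\<close> or with \<open>\<top>\<close>; it
  has exactly two classes.\<close>

lemma point_congruence_congruence_point: "point_congruence L (congruence_point L \<theta>) = \<theta>"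
proof (rule equalityI; rule subrelI)
  note \<theta>D = frame_congruenceD[OF prime_congruence]
  have low: "(\<bottom>, a) \<in> \<theta> \<longleftrightarrow> a \<sqsubseteq> congruence_point L \<theta>"
    and high: "(a, \<top>) \<in> \<theta> \<longleftrightarrow> \<not> a \<sqsubseteq> congruence_point L \<theta>" if "a \<in> carrier L" for a
    using nabla_le_prime_iff[OF that] delta_le_prime_iff[OF that] nabla_le_iff[OF L prime_congruence]
      delta_le_iff[OF L prime_congruence] by simp_all
  fix x y
  show "(x, y) \<in> \<theta>" if "(x, y) \<in> point_congruence L (congruence_point L \<theta>)"
  proof (cases "x \<sqsubseteq> congruence_point L \<theta>")
    case True
    then have "(\<bottom>, x) \<in> \<theta>" "(\<bottom>, y) \<in> \<theta>" using that low by (auto simp: point_congruence_def)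
    then show ?thesis by (rule \<theta>D(4)[OF \<theta>D(3)])
  next
    case False
    then have "(x, \<top>) \<in> \<theta>" "(y, \<top>) \<in> \<theta>" using that high by (auto simp: point_congruence_def)
    then show ?thesis by (rule \<theta>D(4)[OF _ \<theta>D(3)])
  qed
  show "(x, y) \<in> point_congruence L (congruence_point L \<theta>)" if xy: "(x, y) \<in> \<theta>"
  proof -
    note cl = frame_congruence_closed[OF prime_congruence xy]
    have "(\<bottom>, x) \<in> \<theta> \<longleftrightarrow> (\<bottom>, y) \<in> \<theta>"
      using \<theta>D(4)[OF _ xy] \<theta>D(4)[OF _ \<theta>D(3)[OF xy]] by (intro iffI)
    then show ?thesis using cl low by (simp add: point_congruence_def)
  qed
qed

end

lemma congruence_point_point_congruence:
  assumes p: "p \<in> prime_elements L"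
  shows "congruence_point L (point_congruence L p) = p"
  unfolding congruence_point_def
  by (rule spectrum_map_eqI[OF frame_hom_nabla[OF L] point_congruence_prime[OF p] prime_closed[OF L p]])
    (simp add: nabla_map_def nabla_le_iff[OF L point_congruence_congruence[OF p]]
      bottom_point_congruence[OF p])

section \<open>The spatial reflection of the congruence biframe\<close>

abbreviation "CL \<equiv> congruence_frame L"

lemma topspace_congruence_point_space [simp]:
  "topspace (congruence_point_space L) = prime_elements CL"
  using congruence_point_prime
  by (auto simp: congruence_point_space_def topspace_pullback_topology topspace_spectrum[OF L])

lemma openin_congruence_point_space:
  "openin (congruence_point_space L) U \<longleftrightarrow> (\<exists>a\<in>carrier L. U = spectral_open CL (nabla L a))"
proof -
  have "congruence_point L -` spectral_open L a \<inter> prime_elements CL = spectral_open CL (nabla L a)"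
    if "a \<in> carrier L" for a
    using spectrum_map_vimage[OF frame_hom_nabla[OF L] that] that
    by (auto simp: congruence_point_def nabla_map_def)
  then show ?thesis
    by (auto simp: congruence_point_space_def openin_pullback_topology openin_spectrum[OF L])
qed

lemma spectral_open_delta:
  "a \<in> carrier L \<Longrightarrow> spectral_open CL (delta L a) = prime_elements CL - spectral_open CL (nabla L a)"
  by (auto simp: spectral_open_def nabla_le_prime_iff delta_le_prime_iff simp del: le_congruence_frame)

lemma closedin_congruence_point_space:
  "closedin (congruence_point_space L) C \<longleftrightarrow> (\<exists>a\<in>carrier L. C = spectral_open CL (delta L a))"
proof
  assume "closedin (congruence_point_space L) C"
  then obtain a where "a \<in> carrier L" "C \<subseteq> prime_elements CL"
    "prime_elements CL - C = spectral_open CL (nabla L a)"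
    by (auto simp: closedin_def openin_congruence_point_space)
  then show "\<exists>a\<in>carrier L. C = spectral_open CL (delta L a)"
    by (intro bexI[of _ a]) (auto simp: spectral_open_delta)
next
  assume "\<exists>a\<in>carrier L. C = spectral_open CL (delta L a)"
  then obtain a where a: "a \<in> carrier L"
    and C: "C = topspace (congruence_point_space L) - spectral_open CL (nabla L a)"
    by (auto simp: spectral_open_delta)
  have "openin (congruence_point_space L) (spectral_open CL (nabla L a))"
    using a unfolding openin_congruence_point_space by blast
  then show "closedin (congruence_point_space L) C"
    unfolding C by (intro closedin_diff closedin_topspace)
qed

text \<open>A prime congruence fails to contain \<open>\<theta>\<close> iff it separates some pair of \<open>\<theta>\<close>. As it has only two
  classes, its point then lies above exactly one member of the pair; by symmetry of \<open>\<theta>\<close> this may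
  be taken to be the first.\<close>

lemma spectral_open_congruence:
  assumes \<theta>: "frame_congruence L \<theta>"
  shows "spectral_open CL \<theta> =
    (\<Union>(a, b)\<in>\<theta>. spectral_open CL (nabla L b) \<inter> spectral_open CL (delta L a))"
proof (intro equalityI subsetI)
  fix \<phi> assume "\<phi> \<in> spectral_open CL \<theta>"
  then have \<phi>: "\<phi> \<in> prime_elements CL" "\<not> \<theta> \<subseteq> \<phi>" by (simp_all add: spectral_open_def)
  then have "\<not> \<theta> \<subseteq> point_congruence L (congruence_point L \<phi>)"
    by (simp add: point_congruence_congruence_point)
  then obtain a b where ab: "(a, b) \<in> \<theta>" "a \<in> carrier L" "b \<in> carrier L"
    and sep: "a \<sqsubseteq> congruence_point L \<phi>" "\<not> b \<sqsubseteq> congruence_point L \<phi>"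
    using not_le_point_congruence[OF \<theta>] by metis
  have "\<not> le CL (nabla L b) \<phi>" "\<not> le CL (delta L a) \<phi>"
    using sep nabla_le_prime_iff[OF \<phi>(1) ab(3)] delta_le_prime_iff[OF \<phi>(1) ab(2)] by simp_all
  then have "\<phi> \<in> spectral_open CL (nabla L b) \<inter> spectral_open CL (delta L a)"
    using \<phi>(1) by (simp add: spectral_open_def)
  then show "\<phi> \<in> (\<Union>(a, b)\<in>\<theta>. spectral_open CL (nabla L b) \<inter> spectral_open CL (delta L a))"
    using ab(1) by (intro UN_I[of "(a, b)"]) simp_all
next
  fix \<phi> assume "\<phi> \<in> (\<Union>(a, b)\<in>\<theta>. spectral_open CL (nabla L b) \<inter> spectral_open CL (delta L a))"
  then obtain a b where ab: "(a, b) \<in> \<theta>" and \<phi>: "\<phi> \<in> prime_elements CL"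
    and n: "\<not> le CL (nabla L b) \<phi>" "\<not> le CL (delta L a) \<phi>"
    by (auto simp: spectral_open_def)
  note cl = frame_congruence_closed[OF \<theta> ab]
  have "(a, b) \<notin> point_congruence L (congruence_point L \<phi>)"
    using n nabla_le_prime_iff[OF \<phi>] delta_le_prime_iff[OF \<phi>] cl
    by (simp add: point_congruence_def)
  then show "\<phi> \<in> spectral_open CL \<theta>"
    using ab \<phi> point_congruence_congruence_point[OF \<phi>] by (auto simp: spectral_open_def)
qed

lemma skula_congruence_point_space: "skula_topology (congruence_point_space L) = spectrum CL"
proof (rule topology_eq[THEN iffD2], rule allI, rule iffI)
  fix U
  assume "openin (skula_topology (congruence_point_space L)) U"
  then show "openin (spectrum CL) U"
    by (rule skula_coarsest[rotated 2])
      (auto simp: openin_congruence_point_space closedin_congruence_point_space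
        openin_spectrum[OF C.frame_axioms] intro!: bexI nabla_congruence[OF L] delta_congruence[OF L])
next
  fix U
  assume "openin (spectrum CL) U"
  then obtain \<theta> where \<theta>: "frame_congruence L \<theta>" "U = spectral_open CL \<theta>"
    by (auto simp: openin_spectrum[OF C.frame_axioms])
  have "openin (skula_topology (congruence_point_space L))
      (spectral_open CL (nabla L b) \<inter> spectral_open CL (delta L a))" if "(a, b) \<in> \<theta>" for a b
  proof (rule openin_Int[OF openin_imp_skula closed_base_imp_skula[OF closedin_imp_openin_closed_base]])
    show "openin (congruence_point_space L) (spectral_open CL (nabla L b))"
      using frame_congruence_closed[OF \<theta>(1) that] unfolding openin_congruence_point_space by blast
    show "closedin (congruence_point_space L) (spectral_open CL (delta L a))"
      using frame_congruence_closed[OF \<theta>(1) that] unfolding closedin_congruence_point_space by blast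
  qed
  then show "openin (skula_topology (congruence_point_space L)) U"
    unfolding \<theta>(2) spectral_open_congruence[OF \<theta>(1)] by (intro openin_Union) auto
qed

text \<open>The congruences whose spectral open set is a union of closed sets form a subframe containing
  every \<open>\<Delta>\<^sub>a\<close>; conversely a union of closed sets comes from the join of the corresponding
  \<open>\<Delta>\<^sub>a\<close>.\<close>

lemma spectral_open_second_part:
  "spectral_open CL ` generated_subframe CL (delta L ` carrier L) =
    {U. openin (closed_base_topology (congruence_point_space L)) U}"
proof
  let ?open = "openin (closed_base_topology (congruence_point_space L))"
  define A where "A = {\<theta> \<in> carrier CL. ?open (spectral_open CL \<theta>)}"
  have "subframe CL A"
    unfolding subframe_def
  proof (intro conjI ballI allI impI)
    show "A \<subseteq> carrier CL" unfolding A_def by blast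
    have "?open (topspace (closed_base_topology (congruence_point_space L)))" by (rule openin_topspace)
    then have "?open (spectral_open CL \<top>\<^bsub>CL\<^esub>)"
      by (simp add: spectral_open_top[OF C.frame_axioms] topspace_closed_base)
    then show "\<top>\<^bsub>CL\<^esub> \<in> A" using C.top_closed unfolding A_def by blast
  next
    fix \<theta> \<phi>
    assume "\<theta> \<in> A" "\<phi> \<in> A"
    then have c: "\<theta> \<in> carrier CL" "\<phi> \<in> carrier CL"
      and "?open (spectral_open CL \<theta>)" "?open (spectral_open CL \<phi>)" by (simp_all add: A_def)
    then have "?open (spectral_open CL (\<theta> \<sqinter>\<^bsub>CL\<^esub> \<phi>))"
      unfolding spectral_open_meet[OF C.frame_axioms c] by (intro openin_Int)
    then show "\<theta> \<sqinter>\<^bsub>CL\<^esub> \<phi> \<in> A" using C.meet_closed[OF c] unfolding A_def by blast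
  next
    fix S
    assume S: "S \<subseteq> A"
    then have S': "S \<subseteq> carrier CL" unfolding A_def by blast
    have "?open (spectral_open CL (\<Squnion>\<^bsub>CL\<^esub>S))"
      unfolding spectral_open_sup[OF C.frame_axioms S']
      by (rule openin_Union) (use S in \<open>auto simp: A_def\<close>)
    then show "\<Squnion>\<^bsub>CL\<^esub>S \<in> A" using C.sup_closed[OF S'] unfolding A_def by blast
  qed
  moreover have "delta L ` carrier L \<subseteq> A"
  proof (rule image_subsetI)
    fix a assume a: "a \<in> carrier L"
    then have "closedin (congruence_point_space L) (spectral_open CL (delta L a))"
      unfolding closedin_congruence_point_space by blast
    then show "delta L a \<in> A"
      using delta_congruence[OF L a] by (simp add: A_def closedin_imp_openin_closed_base)
  qed
  ultimately have "generated_subframe CL (delta L ` carrier L) \<subseteq> A"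
    unfolding generated_subframe_def by (intro Inter_lower) simp
  then show "spectral_open CL ` generated_subframe CL (delta L ` carrier L) \<subseteq> {U. ?open U}"
    by (auto simp: A_def)
  show "{U. ?open U} \<subseteq> spectral_open CL ` generated_subframe CL (delta L ` carrier L)"
  proof
    fix U assume "U \<in> {U. ?open U}"
    then obtain S where S: "S \<subseteq> {C. closedin (congruence_point_space L) C}" "\<Union>S = U"
      unfolding openin_closed_base by (auto simp: union_of_def arbitrary_def)
    define D where "D = delta L ` {a \<in> carrier L. spectral_open CL (delta L a) \<in> S}"
    have D: "D \<subseteq> carrier CL" "D \<subseteq> delta L ` carrier L"
      by (auto simp: D_def delta_congruence[OF L])
    have "\<Squnion>\<^bsub>CL\<^esub>D \<in> B" if "subframe CL B" "delta L ` carrier L \<subseteq> B" for B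
      using that D(2) by (simp add: subframe_def)
    then have "\<Squnion>\<^bsub>CL\<^esub>D \<in> generated_subframe CL (delta L ` carrier L)"
      unfolding generated_subframe_def by simp
    moreover have "spectral_open CL (\<Squnion>\<^bsub>CL\<^esub>D) = U"
    proof -
      have "spectral_open CL ` D = S"
      proof
        show "spectral_open CL ` D \<subseteq> S" by (auto simp: D_def)
        show "S \<subseteq> spectral_open CL ` D"
        proof
          fix C assume C: "C \<in> S"
          with S(1) have "closedin (congruence_point_space L) C" by blast
          then obtain a where "a \<in> carrier L" "C = spectral_open CL (delta L a)"
            unfolding closedin_congruence_point_space by blast
          with C show "C \<in> spectral_open CL ` D" by (simp add: D_def)
        qed
      qed
      then show ?thesis by (simp add: spectral_open_sup[OF C.frame_axioms D(1)] S(2))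
    qed
    ultimately show "U \<in> spectral_open CL ` generated_subframe CL (delta L ` carrier L)" by auto
  qed
qed

text \<open>After this identification everything about the spatial reflection is an instance of
  functoriality of the Skula biframe.\<close>

lemma spat_congruence_eq_skula: "spat_congruence L = skula (congruence_point_space L)"
proof -
  have "spectral_open CL ` nabla L ` carrier L = {U. openin (congruence_point_space L) U}"
    by (auto simp: openin_congruence_point_space)
  then show ?thesis
    by (simp add: spat_congruence_def biframe_spat_def congruence_biframe_def skula_def spat_def
        skula_congruence_point_space spectral_open_second_part)
qed

lemma continuous_congruence_point:
  "continuous_map (congruence_point_space L) (spectrum L) (congruence_point L)"
  using continuous_map_pullback[OF continuous_map_id[of "spectrum L"]]
  by (simp add: congruence_point_space_def)

lemma continuous_point_congruence:
  "continuous_map (spectrum L) (congruence_point_space L) (point_congruence L)"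
  unfolding congruence_point_space_def
proof (rule continuous_map_pullback')
  show "continuous_map (spectrum L) (spectrum L) (congruence_point L \<circ> point_congruence L)"
    by (rule continuous_map_eq[OF continuous_map_id])
      (simp add: topspace_spectrum[OF L] congruence_point_point_congruence)
qed (use point_congruence_prime in \<open>auto simp: topspace_spectrum[OF L]\<close>)

end

section \<open>The natural isomorphism\<close>

definition spectrum_iso :: "'a gorder \<Rightarrow> 'a set \<Rightarrow> ('a \<times> 'a) set set" where
  "spectrum_iso L = skula_map (congruence_point_space L) (spectrum L) (congruence_point L)"

lemma biframe_iso_spectrum_iso:
  assumes L: "frame L"
  shows "biframe_iso (sk_spectrum L) (spat_congruence L) (spectrum_iso L)"
  unfolding spectrum_iso_def sk_spectrum_def spat_congruence_eq_skula[OF L]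
  by (rule biframe_iso_skula_map[OF continuous_congruence_point[OF L] continuous_point_congruence[OF L]])
    (simp_all add: topspace_congruence_point_space[OF L] topspace_spectrum[OF L]
      point_congruence_congruence_point[OF L] congruence_point_point_congruence[OF L])

context
  fixes L :: "'a gorder" and M :: "'b gorder" and f
  assumes f: "frame_hom L M f"
begin

abbreviation "\<Sigma>C \<equiv> spectrum_map (congruence_frame L) (congruence_frame M) (congruence_map L M f)"

lemma spat_congruence_map_eq_skula_map:
  "spat_congruence_map L M f = skula_map (congruence_point_space M) (congruence_point_space L) \<Sigma>C"
  unfolding spat_congruence_map_def biframe_spat_map_def spat_map_def skula_map_def
  by (simp add: congruence_biframe_def skula_congruence_point_space[OF frame_homD(1)[OF f]]
      skula_congruence_point_space[OF frame_homD(2)[OF f]])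

text \<open>The spectrum functor applied to the naturality square of \<open>a \<mapsto> \<nabla>\<^sub>a\<close>.\<close>

lemma congruence_point_natural:
  assumes "\<theta> \<in> prime_elements (congruence_frame M)"
  shows "congruence_point L (\<Sigma>C \<theta>) = spectrum_map L M f (congruence_point M \<theta>)"
  unfolding congruence_point_def
  using spectrum_map_compose[OF frame_hom_nabla[OF frame_homD(1)[OF f]] frame_hom_congruence_map[OF f] assms]
    spectrum_map_compose[OF f frame_hom_nabla[OF frame_homD(2)[OF f]] assms] nabla_natural[OF f] by simp

lemma continuous_spectrum_congruence_map:
  "continuous_map (congruence_point_space M) (congruence_point_space L) \<Sigma>C"
  unfolding congruence_point_space_def[of L]
proof (rule continuous_map_pullback')
  have "continuous_map (congruence_point_space M) (spectrum L)
      (spectrum_map L M f \<circ> congruence_point M)"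
    by (rule continuous_map_compose[OF continuous_congruence_point[OF frame_homD(2)[OF f]]
          continuous_spectrum_map[OF f]])
  then show "continuous_map (congruence_point_space M) (spectrum L) (congruence_point L \<circ> \<Sigma>C)"
    by (rule continuous_map_eq)
      (simp add: topspace_congruence_point_space[OF frame_homD(2)[OF f]] congruence_point_natural)
qed (use spectrum_map_prime[OF frame_hom_congruence_map[OF f]] in
    \<open>auto simp: topspace_congruence_point_space[OF frame_homD(2)[OF f]]\<close>)

lemma spectrum_iso_natural:
  "compose (carrier (total_part (sk_spectrum L))) (spat_congruence_map L M f) (spectrum_iso L) =
   compose (carrier (total_part (sk_spectrum L))) (spectrum_iso M) (sk_spectrum_map L M f)"
  unfolding sk_spectrum_def sk_spectrum_map_def spectrum_iso_def spat_congruence_map_eq_skula_map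
    skula_map_compose[OF continuous_spectrum_congruence_map continuous_congruence_point[OF frame_homD(1)[OF f]] refl,
      symmetric]
  by (rule skula_map_compose[OF continuous_congruence_point[OF frame_homD(2)[OF f]] continuous_spectrum_map[OF f]])
    (simp add: topspace_congruence_point_space[OF frame_homD(2)[OF f]] congruence_point_natural)

lemma biframe_hom_sk_spectrum_map:
  "biframe_hom (sk_spectrum L) (sk_spectrum M) (sk_spectrum_map L M f)"
  unfolding sk_spectrum_def sk_spectrum_map_def
  by (rule biframe_hom_skula_map[OF continuous_spectrum_map[OF f]])

lemma biframe_hom_spat_congruence_map:
  "biframe_hom (spat_congruence L) (spat_congruence M) (spat_congruence_map L M f)"
  unfolding spat_congruence_eq_skula[OF frame_homD(1)[OF f]] spat_congruence_eq_skula[OF frame_homD(2)[OF f]]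
    spat_congruence_map_eq_skula_map
  by (rule biframe_hom_skula_map[OF continuous_spectrum_congruence_map])

end

lemma sk_spectrum_map_id:
  assumes L: "frame L"
  shows "sk_spectrum_map L L (\<lambda>x\<in>carrier L. x) = (\<lambda>u\<in>carrier (total_part (sk_spectrum L)). u)"
  unfolding sk_spectrum_def sk_spectrum_map_def
  by (rule skula_map_id) (simp add: topspace_spectrum[OF L] spectrum_map_id[OF L])

lemma sk_spectrum_map_compose:
  assumes f: "frame_hom L M f" and g: "frame_hom M N g"
  shows "sk_spectrum_map L N (compose (carrier L) g f) =
    compose (carrier (total_part (sk_spectrum L))) (sk_spectrum_map M N g) (sk_spectrum_map L M f)"
  unfolding sk_spectrum_def sk_spectrum_map_def
  by (rule skula_map_compose[OF continuous_spectrum_map[OF g] continuous_spectrum_map[OF f]])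
    (simp add: topspace_spectrum[OF frame_homD(2)[OF g]] spectrum_map_compose[OF f g])

lemma spat_congruence_map_id:
  assumes L: "frame L"
  shows "spat_congruence_map L L (\<lambda>x\<in>carrier L. x) =
    (\<lambda>u\<in>carrier (total_part (spat_congruence L)). u)"
  unfolding spat_congruence_map_eq_skula_map[OF frame_hom_id[OF L]] spat_congruence_eq_skula[OF L]
    congruence_map_id[OF L]
  by (rule skula_map_id)
    (simp only: topspace_congruence_point_space[OF L] spectrum_map_id[OF frame_congruence_frame[OF L]])

lemma spat_congruence_map_compose:
  assumes f: "frame_hom L M f" and g: "frame_hom M N g"
  shows "spat_congruence_map L N (compose (carrier L) g f) =
    compose (carrier (total_part (spat_congruence L))) (spat_congruence_map M N g)
      (spat_congruence_map L M f)"
  unfolding spat_congruence_map_eq_skula_map[OF f] spat_congruence_map_eq_skula_map[OF g]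
    spat_congruence_map_eq_skula_map[OF frame_hom_compose[OF f g]]
    spat_congruence_eq_skula[OF frame_homD(1)[OF f]] congruence_map_compose[OF f g]
  by (rule skula_map_compose[OF continuous_spectrum_congruence_map[OF g]
        continuous_spectrum_congruence_map[OF f]])
    (simp only: topspace_congruence_point_space[OF frame_homD(2)[OF g]]
      spectrum_map_compose[OF frame_hom_congruence_map[OF f] frame_hom_congruence_map[OF g]])

theorem mainTheorem14:
  shows
    "(\<forall>L :: 'a gorder. frame L \<longrightarrow>
        biframe_isomorphic (skula (spectrum L)) (biframe_spat (congruence_biframe L))) \<and>
     functor_objects (sk_spectrum :: 'a gorder \<Rightarrow> _) \<and>
     functor_morphisms (sk_spectrum :: 'a gorder \<Rightarrow> _) (sk_spectrum :: 'b gorder \<Rightarrow> _)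
       sk_spectrum_map \<and>
     functor_identity (sk_spectrum :: 'a gorder \<Rightarrow> _) sk_spectrum_map \<and>
     functor_composition (sk_spectrum :: 'a gorder \<Rightarrow> _)
       (sk_spectrum_map :: 'a gorder \<Rightarrow> 'b gorder \<Rightarrow> _)
       (sk_spectrum_map :: 'b gorder \<Rightarrow> 'c gorder \<Rightarrow> _)
       (sk_spectrum_map :: 'a gorder \<Rightarrow> 'c gorder \<Rightarrow> _) \<and>
     functor_objects (spat_congruence :: 'a gorder \<Rightarrow> _) \<and>
     functor_morphisms (spat_congruence :: 'a gorder \<Rightarrow> _) (spat_congruence :: 'b gorder \<Rightarrow> _)
       spat_congruence_map \<and>
     functor_identity (spat_congruence :: 'a gorder \<Rightarrow> _) spat_congruence_map \<and>
     functor_composition (spat_congruence :: 'a gorder \<Rightarrow> _)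
       (spat_congruence_map :: 'a gorder \<Rightarrow> 'b gorder \<Rightarrow> _)
       (spat_congruence_map :: 'b gorder \<Rightarrow> 'c gorder \<Rightarrow> _)
       (spat_congruence_map :: 'a gorder \<Rightarrow> 'c gorder \<Rightarrow> _) \<and>
     (\<exists>(\<eta> :: 'a gorder \<Rightarrow> 'a set \<Rightarrow> ('a \<times> 'a) set set)
       (\<eta>' :: 'b gorder \<Rightarrow> 'b set \<Rightarrow> ('b \<times> 'b) set set).
        iso_components sk_spectrum spat_congruence \<eta> \<and>
        iso_components sk_spectrum spat_congruence \<eta>' \<and>
        natural sk_spectrum sk_spectrum_map spat_congruence_map \<eta> \<eta> \<and>
        natural sk_spectrum sk_spectrum_map spat_congruence_map \<eta> \<eta>' \<and>
        natural sk_spectrum sk_spectrum_map spat_congruence_map \<eta>' \<eta> \<and>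
        natural sk_spectrum sk_spectrum_map spat_congruence_map \<eta>' \<eta>')"
  (is "?iso \<and> ?oS \<and> ?mS \<and> ?iS \<and> ?cS \<and> ?oC \<and> ?mC \<and> ?iC \<and> ?cC \<and> ?nat")
proof -
  have ?iso
  proof (intro allI impI)
    fix L :: "'a gorder" assume "frame L"
    then show "biframe_isomorphic (skula (spectrum L)) (biframe_spat (congruence_biframe L))"
      using biframe_iso_spectrum_iso[of L]
      unfolding biframe_isomorphic_def sk_spectrum_def spat_congruence_def by blast
  qed
  moreover have ?oS
    unfolding functor_objects_def sk_spectrum_def by (simp add: strictly_zero_dimensional_skula)
  moreover have ?oC
    unfolding functor_objects_def
    by (simp add: spat_congruence_eq_skula strictly_zero_dimensional_skula)
  moreover have ?mS ?mC
    unfolding functor_morphisms_def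
    by (simp_all add: biframe_hom_sk_spectrum_map biframe_hom_spat_congruence_map)
  moreover have ?iS ?iC
    unfolding functor_identity_def by (simp_all add: sk_spectrum_map_id spat_congruence_map_id)
  moreover have ?cS ?cC
    unfolding functor_composition_def
    by (simp_all add: sk_spectrum_map_compose spat_congruence_map_compose)
  moreover have ?nat
    by (intro exI[of _ spectrum_iso] conjI)
      (simp_all add: iso_components_def natural_def biframe_iso_spectrum_iso spectrum_iso_natural)
  ultimately show ?thesis by blast
qed

end
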